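(* Let $\mathcal{L}(\mathbf{E},\mathbf{B},\varphi,\psi)$ be a smooth function on $\mathbb{R}^3\times\mathbb{R}^3\times\mathbb{R}\times\mathbb{R}$ for which the partial Legendre transform in $(\mathbf{E},\varphi)$ is well defined, as specified in the context. Let $\mathbf{A}(t,\mathbf{x})\in\mathbb{R}^3$, $Z(t,\mathbf{x})\in\mathbb{R}$ be smooth, put $$E_k=-\partial_tA_k,\quad \varphi=-\partial_tZ,\quad B_k=\epsilon_{kij}\partial_iA_j+\partial_kZ,\quad \psi=\partial_kA_k,$$ and suppose $(\mathbf{A},Z)$ satisfies the Euler--Lagrange equations of the action $S[\mathbf{A},Z]=\int\mathcal{L}(\mathbf{E},\mathbf{B},\varphi,\psi)\,\mathrm{d}\mathbf{x}\,\mathrm{d}t$. Define $D_k=\mathcal{L}_{E_k}$, $\phi=\mathcal{L}_\varphi$ and $\mathcal{E}(\mathbf{D},\mathbf{B},\phi,\psi)=E_k\mathcal{L}_{E_k}+\varphi\mathcal{L}_\varphi-\mathcal{L}$. Then $(\mathbf{B},\phi,\mathbf{D},\psi)$ satisfies $$\partial_tB_k+\epsilon_{kij}\partial_i\mathcal{E}_{D_j}+\partial_k\mathcal{E}_\phi=0,\qquad \partial_t\phi+\partial_k\mathcal{E}_{B_k}=0,$$ $$\partial_tD_k-\epsilon_{kij}\partial_i\mathcal{E}_{B_j}+\partial_k\mathcal{E}_\psi=0,\qquad \partial_t\psi+\partial_k\mathcal{E}_{D_k}=0.$$ Moreover, every smooth solution of this last system satisfies the additional conservation law $$\partial_t\mathcal{E}+\partial_k\big(\epsilon_{kij}\mathcal{E}_{D_i}\mathcal{E}_{B_j}+\mathcal{E}_\psi\mathcal{E}_{D_k}+\mathcal{E}_\phi\mathcal{E}_{B_k}\big)=0,$$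 and, if $\mathcal{E}$ is convex (with positive definite Hessian), the system is symmetric hyperbolic: in the dual variables $\mathbf{p}=(\mathcal{E}_{\mathbf{B}},\mathcal{E}_\phi,\mathcal{E}_{\mathbf{D}},\mathcal{E}_\psi)$ and with the potential $L(\mathbf{p})=D_k\mathcal{E}_{D_k}+B_k\mathcal{E}_{B_k}+\phi\mathcal{E}_\phi+\psi\mathcal{E}_\psi-\mathcal{E}$ it takes the form $L_{\mathbf{p}\mathbf{p}}\,\partial_t\mathbf{p}+\sum_{k=1}^3\mathbf{H}_k\,\partial_k\mathbf{p}=0$ with $L_{\mathbf{p}\mathbf{p}}$ symmetric positive definite and constant symmetric matrices $\mathbf{H}_k$.
   Context: Space is three-dimensional, repeated indices are summed over $1,2,3$, $\epsilon_{kij}$ is the Levi-Civita symbol, subscripts such as $\mathcal{L}_{E_k}$, $\mathcal{E}_{D_k}$, $\mathcal{E}_\phi$ denote partial derivatives. The partial Legendre transform is assumed well defined: for every $(\mathbf{B},\psi)$ the map $(\mathbf{E},\varphi)\mapsto(\mathcal{L}_{\mathbf{E}},\mathcal{L}_\varphi)$ is a smooth diffeomorphism onto its image (depending smoothly on $(\mathbf{B},\psi)$), so that $\mathcal{E}$ is a smooth function of $(\mathbf{D},\mathbf{B},\phi,\psi)$; similarly the full Legendre transform $L$ of $\mathcal{E}$ is understood as a function of $\mathbf{p}$ (locally, when the Hessian of $\mathcal{E}$ is positive definite). The Lagrangian is assumed not to depend explicitly on $\mathbf{A}$ and $Z$. The Euler--Lagrange equations for a density $\Lambda$ depending on $u$,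 $\partial_t u$, $\partial_ku$ are $-\partial_t\frac{\partial\Lambda}{\partial(\partial_tu)}-\partial_k\frac{\partial\Lambda}{\partial(\partial_ku)}+\frac{\partial\Lambda}{\partial u}=0$ for $u=A_1,A_2,A_3,Z$. A system $\mathbf{M}\partial_t\mathbf{p}+\sum_k\mathbf{H}_k\partial_k\mathbf{p}=0$ is symmetric hyperbolic if $\mathbf{M}$ is symmetric positive definite and the $\mathbf{H}_k$ are symmetric. Here, writing $\mathbf{p}=(\mathbf{b},f,\mathbf{d},s)$, $\mathbf{H}_k(\mathbf{b},f,\mathbf{d},s)=(\mathbf{e}_k\times\mathbf{d}+f\mathbf{e}_k,\ b_k,\ -\mathbf{e}_k\times\mathbf{b}+s\,\mathbf{e}_k,\ d_k)$. *)

theory Defs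
  imports "HOL-Analysis.Analysis"
begin

section \<open>Smooth maps, gradients, Hessians\<close>

primrec Ck_on :: "nat \<Rightarrow> 'a::euclidean_space set \<Rightarrow> ('a \<Rightarrow> 'b::euclidean_space) \<Rightarrow> bool" where
  "Ck_on 0 S f \<longleftrightarrow> continuous_on S f"
| "Ck_on (Suc n) S f \<longleftrightarrow>
     (\<forall>x\<in>S. f differentiable (at x)) \<and>
     (\<forall>v. Ck_on n S (\<lambda>x. frechet_derivative f (at x) v))"

definition smooth_on :: "'a::euclidean_space set \<Rightarrow> ('a \<Rightarrow> 'b::euclidean_space) \<Rightarrow> bool" where
  "smooth_on S f \<longleftrightarrow> open S \<and> (\<forall>n. Ck_on n S f)"

definition diffeo_onto_image :: "'a::euclidean_space set \<Rightarrow> ('a \<Rightarrow> 'b::euclidean_space) \<Rightarrow> bool" where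
  "diffeo_onto_image S f \<longleftrightarrow>
     smooth_on S f \<and> inj_on f S \<and> smooth_on (f ` S) (inv_into S f)"

definition grad :: "('a::euclidean_space \<Rightarrow> real) \<Rightarrow> 'a \<Rightarrow> 'a" where
  "grad f x = (\<Sum>i\<in>Basis. frechet_derivative f (at x) i *\<^sub>R i)"

text \<open>Matrices on a Euclidean space are rendered as linear operators; relative to the
  orthonormal basis \<open>Basis\<close>, \<open>hess f x\<close> has the second partial derivatives as entries.\<close>

definition hess :: "('a::euclidean_space \<Rightarrow> real) \<Rightarrow> 'a \<Rightarrow> 'a \<Rightarrow> 'a" where
  "hess f x = frechet_derivative (grad f) (at x)"

definition symmetric_op :: "('a::euclidean_space \<Rightarrow> 'a) \<Rightarrow> bool" where
  "symmetric_op M \<longleftrightarrow> linear M \<and> (\<forall>v w. M v \<bullet> w = v \<bullet> M w)"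

definition pos_def_op :: "('a::euclidean_space \<Rightarrow> 'a) \<Rightarrow> bool" where
  "pos_def_op M \<longleftrightarrow> linear M \<and> (\<forall>v. v \<noteq> 0 \<longrightarrow> 0 < M v \<bullet> v)"


section \<open>Fields on space-time\<close>

type_synonym spacetime = "real \<times> (real^3)"

definition dt :: "(spacetime \<Rightarrow> 'a::euclidean_space) \<Rightarrow> spacetime \<Rightarrow> 'a" where
  "dt f X = frechet_derivative f (at X) (1, 0)"

definition dx :: "3 \<Rightarrow> (spacetime \<Rightarrow> 'a::euclidean_space) \<Rightarrow> spacetime \<Rightarrow> 'a" where
  "dx k f X = frechet_derivative f (at X) (0, axis k 1)"

definition eps :: "3 \<Rightarrow> 3 \<Rightarrow> 3 \<Rightarrow> real" where
  "eps k i j =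
     (if (k, i, j) \<in> {(1, 2, 3), (2, 3, 1), (3, 1, 2)} then 1
      else if (k, i, j) \<in> {(1, 3, 2), (2, 1, 3), (3, 2, 1)} then -1
      else 0)"

text \<open>First-order jets \<open>(u, \<partial>\<^sub>tu, (\<partial>\<^sub>1u, \<partial>\<^sub>2u, \<partial>\<^sub>3u))\<close>; a Lagrangian density is a function of these.\<close>

type_synonym 'u jet = "'u \<times> 'u \<times> ('u^3)"

definition jet :: "(spacetime \<Rightarrow> 'u::euclidean_space) \<Rightarrow> spacetime \<Rightarrow> 'u jet" where
  "jet u X = (u X, dt u X, \<chi> k. dx k u X)"

definition euler_lagrange ::
  "('u::euclidean_space jet \<Rightarrow> real) \<Rightarrow> spacetime set \<Rightarrow> (spacetime \<Rightarrow> 'u) \<Rightarrow> bool" where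
  "euler_lagrange \<Lambda> \<Omega> u \<longleftrightarrow>
     (\<forall>X\<in>\<Omega>. \<forall>i\<in>Basis.
        - dt (\<lambda>Y. frechet_derivative \<Lambda> (at (jet u Y)) (0, i, 0)) X
        - (\<Sum>k\<in>UNIV. dx k (\<lambda>Y. frechet_derivative \<Lambda> (at (jet u Y)) (0, 0, axis k i)) X)
        + frechet_derivative \<Lambda> (at (jet u X)) (i, 0, 0) = 0)"


section \<open>The Lagrangian in terms of the potentials\<close>

text \<open>The variables \<open>(E, B, \<phi>, \<psi>)\<close> of the Lagrangian, where \<open>\<phi> = - \<partial>\<^sub>tZ\<close>.\<close>

type_synonym lag_vars = "(real^3) \<times> (real^3) \<times> real \<times> real"

text \<open>Here \<open>u = (A, Z)\<close>, so \<open>fst (G $ i) $ j\<close> is \<open>\<partial>\<^sub>iA\<^sub>j\<close> and \<open>snd (G $ k)\<close> is \<open>\<partial>\<^sub>kZ\<close>.\<close>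

fun em_fields :: "((real^3) \<times> real) jet \<Rightarrow> lag_vars" where
  "em_fields (u, (At, Zt), G) =
     (- At,
      \<chi> k. (\<Sum>i\<in>UNIV. \<Sum>j\<in>UNIV. eps k i j * fst (G $ i) $ j) + snd (G $ k),
      - Zt,
      \<Sum>k\<in>UNIV. fst (G $ k) $ k)"

definition lagrangian_density :: "(lag_vars \<Rightarrow> real) \<Rightarrow> ((real^3) \<times> real) jet \<Rightarrow> real" where
  "lagrangian_density L J = L (em_fields J)"


section \<open>The partial Legendre transform\<close>

text \<open>\<open>(E, \<phi>) \<mapsto> (L\<^sub>E, L\<^sub>\<phi>)\<close> for fixed \<open>(B, \<psi>)\<close>.\<close>

definition legendre_map ::
  "(lag_vars \<Rightarrow> real) \<Rightarrow> (real^3) \<Rightarrow> real \<Rightarrow> (real^3) \<times> real \<Rightarrow> (real^3) \<times> real" where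
  "legendre_map L B \<psi> = grad (\<lambda>(E, \<phi>). L (E, B, \<phi>, \<psi>))"

text \<open>States are ordered as \<open>(B, \<phi>, D, \<psi>)\<close>, with \<open>\<phi>\<close> now the conjugate variable. The energy
  takes its arguments in this order as well, so that its gradient is the tuple of dual variables
  \<open>p = (\<E>\<^sub>B, \<E>\<^sub>\<phi>, \<E>\<^sub>D, \<E>\<^sub>\<psi>)\<close>.\<close>

type_synonym state = "(real^3) \<times> real \<times> (real^3) \<times> real"

definition B_of :: "state \<Rightarrow> (real^3)" where "B_of q = fst q"
definition phi_of :: "state \<Rightarrow> real" where "phi_of q = fst (snd q)"
definition D_of :: "state \<Rightarrow> (real^3)" where "D_of q = fst (snd (snd q))"
definition psi_of :: "state \<Rightarrow> real" where "psi_of q = snd (snd (snd q))"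

definition legendre_domain :: "(lag_vars \<Rightarrow> real) \<Rightarrow> state set" where
  "legendre_domain L = {(B, \<phi>, D, \<psi>). (D, \<phi>) \<in> range (legendre_map L B \<psi>)}"

definition partial_legendre_well_defined :: "(lag_vars \<Rightarrow> real) \<Rightarrow> bool" where
  "partial_legendre_well_defined L \<longleftrightarrow>
     (\<forall>B \<psi>. diffeo_onto_image UNIV (legendre_map L B \<psi>)) \<and>
     smooth_on (legendre_domain L) (\<lambda>(B, \<phi>, D, \<psi>). inv (legendre_map L B \<psi>) (D, \<phi>))"

text \<open>The values of \<open>energy L\<close> are meaningful on \<open>legendre_domain L\<close> only.\<close>

fun energy :: "(lag_vars \<Rightarrow> real) \<Rightarrow> state \<Rightarrow> real" where
  "energy L (B, \<phi>, D, \<psi>) =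
     (let (E, \<phi>') = inv (legendre_map L B \<psi>) (D, \<phi>)
      in E \<bullet> D + \<phi>' * \<phi> - L (E, B, \<phi>', \<psi>))"

definition state_of :: "(lag_vars \<Rightarrow> real) \<Rightarrow>
    (spacetime \<Rightarrow> (real^3)) \<Rightarrow> (spacetime \<Rightarrow> real) \<Rightarrow> spacetime \<Rightarrow> state" where
  "state_of L A Z X =
     (let (E, B, \<phi>', \<psi>) = em_fields (jet (\<lambda>Y. (A Y, Z Y)) X);
          (D, \<phi>) = legendre_map L B \<psi> (E, \<phi>')
      in (B, \<phi>, D, \<psi>))"


section \<open>The first-order system\<close>

definition smooth_solution ::
  "state set \<Rightarrow> (state \<Rightarrow> real) \<Rightarrow> spacetime set \<Rightarrow> (spacetime \<Rightarrow> state) \<Rightarrow> bool" where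
  "smooth_solution W \<E> \<Omega> q \<longleftrightarrow>
     smooth_on \<Omega> q \<and> q ` \<Omega> \<subseteq> W \<and>
     (\<forall>X\<in>\<Omega>.
       (\<forall>k. dt (\<lambda>Y. B_of (q Y) $ k) X
            + (\<Sum>i\<in>UNIV. \<Sum>j\<in>UNIV. eps k i j * dx i (\<lambda>Y. D_of (grad \<E> (q Y)) $ j) X)
            + dx k (\<lambda>Y. phi_of (grad \<E> (q Y))) X = 0) \<and>
       dt (\<lambda>Y. phi_of (q Y)) X + (\<Sum>k\<in>UNIV. dx k (\<lambda>Y. B_of (grad \<E> (q Y)) $ k) X) = 0 \<and>
       (\<forall>k. dt (\<lambda>Y. D_of (q Y) $ k) X
            - (\<Sum>i\<in>UNIV. \<Sum>j\<in>UNIV. eps k i j * dx i (\<lambda>Y. B_of (grad \<E> (q Y)) $ j) X)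
            + dx k (\<lambda>Y. psi_of (grad \<E> (q Y))) X = 0) \<and>
       dt (\<lambda>Y. psi_of (q Y)) X + (\<Sum>k\<in>UNIV. dx k (\<lambda>Y. D_of (grad \<E> (q Y)) $ k) X) = 0)"

text \<open>The flux of the additional conservation law, as a function of \<open>p = grad \<E> q\<close>.\<close>

definition energy_flux :: "3 \<Rightarrow> state \<Rightarrow> real" where
  "energy_flux k p =
     (\<Sum>i\<in>UNIV. \<Sum>j\<in>UNIV. eps k i j * D_of p $ i * B_of p $ j)
     + psi_of p * D_of p $ k + phi_of p * B_of p $ k"

definition energy_conservation ::
  "(state \<Rightarrow> real) \<Rightarrow> spacetime set \<Rightarrow> (spacetime \<Rightarrow> state) \<Rightarrow> bool" where
  "energy_conservation \<E> \<Omega> q \<longleftrightarrow>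
     (\<forall>X\<in>\<Omega>. dt (\<lambda>Y. \<E> (q Y)) X
            + (\<Sum>k\<in>UNIV. dx k (\<lambda>Y. energy_flux k (grad \<E> (q Y))) X) = 0)"


section \<open>Symmetric hyperbolic form\<close>

definition symmetric_hyperbolic ::
  "'a::euclidean_space set \<Rightarrow> ('a \<Rightarrow> 'a \<Rightarrow> 'a) \<Rightarrow> (3 \<Rightarrow> 'a \<Rightarrow> 'a) \<Rightarrow> bool" where
  "symmetric_hyperbolic P M H \<longleftrightarrow>
     (\<forall>p\<in>P. symmetric_op (M p) \<and> pos_def_op (M p)) \<and> (\<forall>k. symmetric_op (H k))"

definition satisfies_quasilinear :: "('a::euclidean_space \<Rightarrow> 'a \<Rightarrow> 'a) \<Rightarrow> (3 \<Rightarrow> 'a \<Rightarrow> 'a) \<Rightarrow>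
    spacetime set \<Rightarrow> (spacetime \<Rightarrow> 'a) \<Rightarrow> bool" where
  "satisfies_quasilinear M H \<Omega> p \<longleftrightarrow>
     (\<forall>X\<in>\<Omega>. M (p X) (dt p X) + (\<Sum>k\<in>UNIV. H k (dx k p X)) = 0)"

fun H_op :: "3 \<Rightarrow> state \<Rightarrow> state" where
  "H_op k (b, f, d, s) =
     (cross3 (axis k 1) d + f *\<^sub>R axis k 1, b $ k,
      - cross3 (axis k 1) b + s *\<^sub>R axis k 1, d $ k)"

text \<open>The full Legendre transform of \<open>\<E>\<close> on a set \<open>V\<close> where \<open>grad \<E>\<close> is injective,
  as a function of \<open>p \<in> grad \<E> ` V\<close>.\<close>

definition legendre_potential :: "state set \<Rightarrow> (state \<Rightarrow> real) \<Rightarrow> state \<Rightarrow> real" where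
  "legendre_potential V \<E> p = (let q = inv_into V (grad \<E>) p in q \<bullet> p - \<E> q)"

end

theory Submission
  imports Defs
begin

text \<open>Write \<open>q = (B, \<phi>, D, \<psi>)\<close> for the state and \<open>p = grad \<E> q\<close> for its dual. All four groups of
  evolution equations are the blocks of the single equation
  \<open>\<partial>\<^sub>tq + (\<Sum>k. H\<^sub>k \<partial>\<^sub>kp) = 0\<close> with constant symmetric operators \<open>H\<^sub>k\<close> (\<open>smooth_solution_iff\<close>,
  \<open>symmetric_H_op\<close>), and every claim is read off from this form.

  The state of a solution of the Euler--Lagrange equations solves it because the envelope theorem
  gives \<open>p = (- L\<^sub>B, \<phi>', E, - L\<^sub>\<psi>)\<close>, where \<open>\<phi>' = - \<partial>\<^sub>tZ\<close> (\<open>grad_energy\<close>). With these values the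
  equations for \<open>D\<close> and \<open>\<phi>\<close> are the Euler--Lagrange equations, and those for \<open>B\<close> and \<open>\<psi>\<close> hold
  because derivatives of the potentials commute (\<open>euler_lagrange_imp_solution\<close>).

  The energy flux is \<open>(p \<bullet> H\<^sub>k p) / 2\<close>. By symmetry its divergence is \<open>p \<bullet> (\<Sum>k. H\<^sub>k \<partial>\<^sub>kp)\<close>, while
  \<open>\<partial>\<^sub>t\<E> = p \<bullet> \<partial>\<^sub>tq\<close>, so energy conservation is the equation paired with \<open>p\<close>
  (\<open>energy_conservation_of_solution\<close>).

  Where the Hessian of \<open>\<E>\<close> is positive definite, \<open>grad \<E>\<close> is injective on convex sets
  (\<open>grad_inj_on_convex\<close>) and, wherever it is injective, has the gradient of the Legendre transform as
  a smooth inverse (\<open>smooth_inverse\<close>, \<open>grad_legendre_potential\<close>). Hence the Hessian of the Legendre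
  transform inverts that of \<open>\<E>\<close>, is symmetric and positive definite, and maps \<open>\<partial>\<^sub>tp\<close> to \<open>\<partial>\<^sub>tq\<close>, which
  turns the system into its symmetric hyperbolic form (\<open>smooth_solution_iff_quasilinear\<close>).

  The calculus of smooth maps needed for this is developed first, with the symmetry of second
  derivatives and the smoothness of inverse maps.\<close>

section \<open>Calculus of smooth maps\<close>

lemma grad_eqI:
  assumes "(f has_derivative (\<lambda>v. g \<bullet> v)) (at x)"
  shows "grad f x = g"
proof -
  have "frechet_derivative f (at x) = (\<lambda>v. g \<bullet> v)"
    using frechet_derivative_at[OF assms] by simp
  then show ?thesis
    by (simp add: grad_def euclidean_representation)
qed

lemma frechet_derivative_eq_sum_Basis:
  fixes f :: "'a::euclidean_space \<Rightarrow> 'b::euclidean_space"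
  assumes "f differentiable (at x)"
  shows "frechet_derivative f (at x) v = (\<Sum>b\<in>Basis. (v \<bullet> b) *\<^sub>R frechet_derivative f (at x) b)"
proof -
  interpret linear "frechet_derivative f (at x)"
    using assms by (rule linear_frechet_derivative)
  have "frechet_derivative f (at x) v = frechet_derivative f (at x) (\<Sum>b\<in>Basis. (v \<bullet> b) *\<^sub>R b)"
    by (simp add: euclidean_representation)
  also have "\<dots> = (\<Sum>b\<in>Basis. (v \<bullet> b) *\<^sub>R frechet_derivative f (at x) b)"
    by (simp only: sum scale)
  finally show ?thesis .
qed

lemma frechet_derivative_eq_grad:
  fixes f :: "'a::euclidean_space \<Rightarrow> real"
  assumes "f differentiable (at x)"
  shows "frechet_derivative f (at x) v = grad f x \<bullet> v"
  by (subst frechet_derivative_eq_sum_Basis[OF assms])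
     (simp add: grad_def inner_sum_left inner_commute[of v] mult.commute)

lemma has_derivative_grad:
  fixes f :: "'a::euclidean_space \<Rightarrow> real"
  assumes "f differentiable (at x)"
  shows "(f has_derivative (\<lambda>v. grad f x \<bullet> v)) (at x)"
proof -
  have "frechet_derivative f (at x) = (\<lambda>v. grad f x \<bullet> v)"
    using frechet_derivative_eq_grad[OF assms] by (rule ext)
  then show ?thesis
    using assms unfolding frechet_derivative_works by metis
qed

lemma Ck_on_cong:
  assumes "open S" "\<And>x. x \<in> S \<Longrightarrow> f x = g x" "Ck_on n S f"
  shows "Ck_on n S g"
  using assms(2,3)
proof (induction n arbitrary: f g)
  case 0
  then show ?case by (auto cong: continuous_on_cong)
next
  case (Suc n)
  have d: "(g has_derivative frechet_derivative f (at x)) (at x)" if "x \<in> S" for x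
    using Suc.prems that assms(1)
    by (auto intro: has_derivative_transform_within_open simp: frechet_derivative_works)
  have e: "frechet_derivative g (at x) = frechet_derivative f (at x)" if "x \<in> S" for x
    using frechet_derivative_at[OF d[OF that]] by simp
  show ?case
  proof (simp, intro conjI ballI allI)
    show "g differentiable at x" if "x \<in> S" for x
      using d[OF that] by (auto simp: differentiable_def)
    fix v
    show "Ck_on n S (\<lambda>x. frechet_derivative g (at x) v)"
      by (rule Suc.IH[of "\<lambda>x. frechet_derivative f (at x) v"]) (use Suc.prems e in auto)
  qed
qed

text \<open>In the recursion for \<open>Ck_on\<close> the derivative is that chosen by \<open>frechet_derivative\<close>; any formula
  for the derivative may take its place.\<close>

lemma Ck_on_SucI:
  assumes "open S" "\<And>x. x \<in> S \<Longrightarrow> (f has_derivative f' x) (at x)"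
    and "\<And>v. Ck_on n S (\<lambda>x. f' x v)"
  shows "Ck_on (Suc n) S f"
proof (simp, intro conjI ballI allI)
  show "f differentiable at x" if "x \<in> S" for x
    using assms(2)[OF that] by (auto simp: differentiable_def)
  fix v
  show "Ck_on n S (\<lambda>x. frechet_derivative f (at x) v)"
    using assms(1) _ assms(3)[of v]
    by (rule Ck_on_cong) (simp add: frechet_derivative_at[OF assms(2), symmetric])
qed

lemma Ck_on_SucD:
  assumes "Ck_on (Suc n) S f"
  shows "x \<in> S \<Longrightarrow> (f has_derivative frechet_derivative f (at x)) (at x)"
    and "Ck_on n S (\<lambda>x. frechet_derivative f (at x) v)"
  using assms by (auto simp: frechet_derivative_works)

lemma Ck_on_Suc_imp:
  "Ck_on (Suc n) S f \<Longrightarrow> Ck_on n S f"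
proof (induction n arbitrary: f)
  case 0
  then show ?case
    by (auto intro!: continuous_at_imp_continuous_on differentiable_imp_continuous_within)
next
  case (Suc n)
  then show ?case
    by simp
qed

lemma Ck_on_const:
  "open S \<Longrightarrow> Ck_on n S (\<lambda>x. c)"
proof (induction n arbitrary: c)
  case (Suc n)
  show ?case
    by (rule Ck_on_SucI[where f' = "\<lambda>x v. 0"]) (use Suc in auto)
qed simp

lemma Ck_on_linear:
  fixes h :: "'b::euclidean_space \<Rightarrow> 'c::euclidean_space"
  assumes "open S" "bounded_linear h"
  shows "Ck_on n S f \<Longrightarrow> Ck_on n S (\<lambda>x. h (f x))"
proof (induction n arbitrary: f)
  case 0
  then show ?case
    using bounded_linear.continuous_on[OF assms(2)] by auto
next
  case (Suc n)
  show ?case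
  proof (rule Ck_on_SucI[OF assms(1)])
    show "((\<lambda>x. h (f x)) has_derivative (\<lambda>v. h (frechet_derivative f (at x) v))) (at x)" if "x \<in> S" for x
      by (rule bounded_linear.has_derivative[OF assms(2) Ck_on_SucD(1)[OF Suc.prems that]])
    show "Ck_on n S (\<lambda>x. h (frechet_derivative f (at x) v))" for v
      by (rule Suc.IH[OF Ck_on_SucD(2)[OF Suc.prems]])
  qed
qed

lemma Ck_on_ident:
  assumes "open S"
  shows "Ck_on n S (\<lambda>x. x)"
proof (cases n)
  case (Suc m)
  show ?thesis unfolding Suc
    by (rule Ck_on_SucI[where f' = "\<lambda>x v. v"]) (use assms in \<open>auto simp: Ck_on_const\<close>)
qed simp

lemma Ck_on_add:
  assumes "open S"
  shows "Ck_on n S f \<Longrightarrow> Ck_on n S g \<Longrightarrow> Ck_on n S (\<lambda>x. f x + g x)"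
proof (induction n arbitrary: f g)
  case 0
  then show ?case
    by (simp add: continuous_on_add)
next
  case (Suc n)
  show ?case
  proof (rule Ck_on_SucI[OF assms])
    show "((\<lambda>x. f x + g x) has_derivative
        (\<lambda>v. frechet_derivative f (at x) v + frechet_derivative g (at x) v)) (at x)" if "x \<in> S" for x
      by (rule has_derivative_add[OF Suc.prems[THEN Ck_on_SucD(1)], OF that that])
    show "Ck_on n S (\<lambda>x. frechet_derivative f (at x) v + frechet_derivative g (at x) v)" for v
      by (rule Suc.IH[OF Suc.prems[THEN Ck_on_SucD(2)]])
  qed
qed

lemma Ck_on_sum:
  assumes "open S"
  shows "(\<And>i. i \<in> I \<Longrightarrow> Ck_on n S (f i)) \<Longrightarrow> Ck_on n S (\<lambda>x. \<Sum>i\<in>I. f i x)"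
proof (induction I rule: infinite_finite_induct)
  case (insert i I)
  then show ?case
    using Ck_on_add[OF assms, of n "f i" "\<lambda>x. \<Sum>i\<in>I. f i x"] by simp
qed (simp_all add: assms Ck_on_const)

lemma Ck_on_bilinear:
  fixes prod :: "'b::euclidean_space \<Rightarrow> 'c::euclidean_space \<Rightarrow> 'd::euclidean_space"
  assumes "open S" "bounded_bilinear prod"
  shows "Ck_on n S f \<Longrightarrow> Ck_on n S g \<Longrightarrow> Ck_on n S (\<lambda>x. prod (f x) (g x))"
proof (induction n arbitrary: f g)
  case 0
  then show ?case
    using bounded_bilinear.continuous_on[OF assms(2)] by auto
next
  case (Suc n)
  show ?case
  proof (rule Ck_on_SucI[OF assms(1)])
    show "((\<lambda>x. prod (f x) (g x)) has_derivative (\<lambda>v. prod (f x) (frechet_derivative g (at x) v)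
        + prod (frechet_derivative f (at x) v) (g x))) (at x)" if "x \<in> S" for x
      by (rule bounded_bilinear.FDERIV[OF assms(2) Suc.prems[THEN Ck_on_SucD(1)], OF that that])
    show "Ck_on n S (\<lambda>x. prod (f x) (frechet_derivative g (at x) v)
        + prod (frechet_derivative f (at x) v) (g x))" for v
      by (intro Ck_on_add assms(1) Suc.IH Suc.prems[THEN Ck_on_SucD(2)] Suc.prems[THEN Ck_on_Suc_imp])
  qed
qed

text \<open>Expanding the chain rule over a basis separates the point at which the derivative of \<open>g\<close> is taken
  from its direction. This leaves sums of products of compositions with one derivative less.\<close>

lemma Ck_on_compose:
  fixes g :: "'b::euclidean_space \<Rightarrow> 'c::euclidean_space"
  assumes "open S" "f ` S \<subseteq> T"
  shows "Ck_on n S f \<Longrightarrow> Ck_on n T g \<Longrightarrow> Ck_on n S (\<lambda>x. g (f x))"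
proof (induction n arbitrary: g)
  case 0
  then show ?case
    using assms by (auto intro: continuous_on_compose2)
next
  case (Suc n)
  note f = Ck_on_SucD[OF Suc.prems(1)] and g = Ck_on_SucD[OF Suc.prems(2)]
  show ?case
  proof (rule Ck_on_SucI[OF assms(1), where f' = "\<lambda>x v. \<Sum>b\<in>Basis.
      (frechet_derivative f (at x) v \<bullet> b) *\<^sub>R frechet_derivative g (at (f x)) b"])
    fix x assume x: "x \<in> S"
    with assms have fx: "f x \<in> T" by auto
    then have "g differentiable at (f x)"
      using g(1) by (auto simp: differentiable_def)
    then have "frechet_derivative g (at (f x)) \<circ> frechet_derivative f (at x) = (\<lambda>v. \<Sum>b\<in>Basis.
      (frechet_derivative f (at x) v \<bullet> b) *\<^sub>R frechet_derivative g (at (f x)) b)"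
      unfolding o_def by (intro ext frechet_derivative_eq_sum_Basis)
    with diff_chain_at[OF f(1)[OF x] g(1)[OF fx]]
    show "((\<lambda>x. g (f x)) has_derivative (\<lambda>v. \<Sum>b\<in>Basis.
      (frechet_derivative f (at x) v \<bullet> b) *\<^sub>R frechet_derivative g (at (f x)) b)) (at x)"
      by (simp only: o_def)
  next
    fix v
    show "Ck_on n S (\<lambda>x. \<Sum>b\<in>Basis. (frechet_derivative f (at x) v \<bullet> b) *\<^sub>R frechet_derivative g (at (f x)) b)"
      using assms(1) Ck_on_linear[OF assms(1) bounded_linear_inner_left f(2)]
        Suc.IH[OF Suc.prems(1)[THEN Ck_on_Suc_imp] g(2)]
      by (intro Ck_on_sum Ck_on_bilinear[OF _ bounded_bilinear_scaleR])
  qed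
qed

lemma smooth_onD_open: "smooth_on S f \<Longrightarrow> open S"
  by (simp add: smooth_on_def)

lemma smooth_on_differentiable:
  assumes "smooth_on S f" "x \<in> S"
  shows "f differentiable (at x)"
proof -
  have "Ck_on (Suc 0) S f" using assms(1) unfolding smooth_on_def by blast
  then show ?thesis using assms(2) by simp
qed

lemma smooth_on_has_derivative:
  "smooth_on S f \<Longrightarrow> x \<in> S \<Longrightarrow> (f has_derivative frechet_derivative f (at x)) (at x)"
  using smooth_on_differentiable frechet_derivative_works by blast

lemma smooth_on_continuous:
  "smooth_on S f \<Longrightarrow> continuous_on S f"
  unfolding smooth_on_def using Ck_on.simps(1)[of S f] by metis

lemma Ck_on_subset:
  "Ck_on n S f \<Longrightarrow> T \<subseteq> S \<Longrightarrow> Ck_on n T f"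
proof (induction n arbitrary: f)
  case 0
  then show ?case by (simp add: continuous_on_subset)
next
  case (Suc n)
  then show ?case by (simp add: subset_iff)
qed

lemma smooth_on_subset:
  "smooth_on S f \<Longrightarrow> T \<subseteq> S \<Longrightarrow> open T \<Longrightarrow> smooth_on T f"
  unfolding smooth_on_def using Ck_on_subset[of _ S f T] by blast

lemma smooth_on_cong:
  "smooth_on S f \<Longrightarrow> (\<And>x. x \<in> S \<Longrightarrow> f x = g x) \<Longrightarrow> smooth_on S g"
  by (auto simp: smooth_on_def intro: Ck_on_cong[of S f g])

lemma smooth_on_ident: "open S \<Longrightarrow> smooth_on S (\<lambda>x. x)"
  by (simp add: smooth_on_def Ck_on_ident)

lemma smooth_on_linear:
  "bounded_linear h \<Longrightarrow> smooth_on S f \<Longrightarrow> smooth_on S (\<lambda>x. h (f x))"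
  for h :: "'b::euclidean_space \<Rightarrow> 'c::euclidean_space"
  by (simp add: smooth_on_def Ck_on_linear[of S h _ f])

lemma smooth_on_add:
  "smooth_on S f \<Longrightarrow> smooth_on S g \<Longrightarrow> smooth_on S (\<lambda>x. f x + g x)"
  by (simp add: smooth_on_def Ck_on_add[of S _ f g])

lemma smooth_on_sum:
  "open S \<Longrightarrow> (\<And>i. i \<in> I \<Longrightarrow> smooth_on S (f i)) \<Longrightarrow> smooth_on S (\<lambda>x. \<Sum>i\<in>I. f i x)"
  by (simp add: smooth_on_def Ck_on_sum[of S I _ f])

lemma smooth_on_bilinear:
  "bounded_bilinear prod \<Longrightarrow> smooth_on S f \<Longrightarrow> smooth_on S g \<Longrightarrow> smooth_on S (\<lambda>x. prod (f x) (g x))"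
  for prod :: "'b::euclidean_space \<Rightarrow> 'c::euclidean_space \<Rightarrow> 'd::euclidean_space"
  by (simp add: smooth_on_def Ck_on_bilinear[of S prod _ f g])

lemma smooth_on_compose:
  "smooth_on S f \<Longrightarrow> smooth_on T g \<Longrightarrow> f ` S \<subseteq> T \<Longrightarrow> smooth_on S (\<lambda>x. g (f x))"
  unfolding smooth_on_def using Ck_on_compose[of S f T _ g] by blast

lemma smooth_on_minus: "smooth_on S f \<Longrightarrow> smooth_on S (\<lambda>x. - f x)"
  by (rule smooth_on_linear[OF bounded_linear_minus[OF bounded_linear_ident]])

lemma smooth_on_diff:
  "smooth_on S f \<Longrightarrow> smooth_on S g \<Longrightarrow> smooth_on S (\<lambda>x. f x - g x)"
  using smooth_on_add[OF _ smooth_on_minus, of S f g] by simp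

lemma smooth_on_Pair:
  fixes f :: "'a::euclidean_space \<Rightarrow> 'b::euclidean_space" and g :: "'a \<Rightarrow> 'c::euclidean_space"
  assumes "smooth_on S f" "smooth_on S g"
  shows "smooth_on S (\<lambda>x. (f x, g x))"
proof -
  have "smooth_on S (\<lambda>x. (f x, 0::'c) + (0::'b, g x))"
    by (intro smooth_on_add smooth_on_linear[of "\<lambda>y. (y, 0)"] smooth_on_linear[of "\<lambda>y. (0, y)"]
        bounded_linear_Pair bounded_linear_ident bounded_linear_zero assms)
  then show ?thesis by simp
qed

lemma smooth_on_deriv:
  "smooth_on S f \<Longrightarrow> smooth_on S (\<lambda>x. frechet_derivative f (at x) v)"
  using Ck_on_SucD(2)[of _ S f v] by (simp add: smooth_on_def del: Ck_on.simps)

lemma smooth_on_grad: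
  assumes "smooth_on S f"
  shows "smooth_on S (grad f)"
proof -
  have "smooth_on S (\<lambda>x. \<Sum>i\<in>Basis. frechet_derivative f (at x) i *\<^sub>R i)"
    using assms by (intro smooth_on_sum smooth_on_linear[OF bounded_linear_scaleR_left]
      smooth_on_deriv) (auto dest: smooth_onD_open)
  then show ?thesis by (rule smooth_on_cong) (simp add: grad_def)
qed

lemma frechet_derivative_linear_compose:
  assumes "bounded_linear h" "f differentiable (at x)"
  shows "frechet_derivative (\<lambda>y. h (f y)) (at x) v = h (frechet_derivative f (at x) v)"
proof -
  have "((\<lambda>y. h (f y)) has_derivative (\<lambda>v. h (frechet_derivative f (at x) v))) (at x)"
    using assms(2) unfolding frechet_derivative_works by (rule bounded_linear.has_derivative[OF assms(1)])
  from fun_cong[OF frechet_derivative_at[OF this], of v] show ?thesis by simp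
qed

section \<open>Symmetry of second derivatives\<close>

text \<open>The mean value theorem, applied once in each of the two directions, expresses the mixed second
  difference by a mixed second derivative at an intermediate point. As the second difference does not
  depend on the order of the two directions, letting \<open>h\<close> tend to \<open>0\<close> proves symmetry.\<close>

lemma second_difference_mean_value:
  fixes f :: "'a::euclidean_space \<Rightarrow> real"
  assumes f: "smooth_on S f" and "0 < h"
    and S: "\<And>s t. 0 \<le> s \<Longrightarrow> s \<le> h \<Longrightarrow> 0 \<le> t \<Longrightarrow> t \<le> h \<Longrightarrow> x + s *\<^sub>R u + t *\<^sub>R v \<in> S"
  obtains s t where "0 \<le> s" "s \<le> h" "0 \<le> t" "t \<le> h"
    "f (x + h *\<^sub>R u + h *\<^sub>R v) - f (x + h *\<^sub>R u) - f (x + h *\<^sub>R v) + f x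
      = h\<^sup>2 * frechet_derivative (\<lambda>y. frechet_derivative f (at y) u) (at (x + s *\<^sub>R u + t *\<^sub>R v)) v"
proof -
  have lin: "linear (frechet_derivative g (at y))" if "smooth_on S g" "y \<in> S" for g :: "'a \<Rightarrow> real" and y
    using smooth_on_differentiable[OF that] by (rule linear_frechet_derivative)
  have line: "((\<lambda>s. g (c s)) has_real_derivative frechet_derivative g (at (c s)) w) (at s)"
    if "smooth_on S g" "c s \<in> S" "(c has_vector_derivative w) (at s)" for g :: "'a \<Rightarrow> real" and c s w
    using diff_chain_at[OF that(3)[unfolded has_vector_derivative_def] smooth_on_has_derivative[OF that(1,2)]]
      linear_scale[OF lin[OF that(1,2)]]
    by (simp add: o_def has_field_derivative_def mult_commute_abs)
  obtain s where s: "0 < s" "s < h" and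
    "(f (x + h *\<^sub>R u + h *\<^sub>R v) - f (x + h *\<^sub>R u)) - (f (x + 0 *\<^sub>R u + h *\<^sub>R v) - f (x + 0 *\<^sub>R u)) = (h - 0) *
      (frechet_derivative f (at (x + s *\<^sub>R u + h *\<^sub>R v)) u - frechet_derivative f (at (x + s *\<^sub>R u)) u)"
  proof -
    have "\<exists>s>0. s < h \<and> (f (x + h *\<^sub>R u + h *\<^sub>R v) - f (x + h *\<^sub>R u)) - (f (x + 0 *\<^sub>R u + h *\<^sub>R v) - f (x + 0 *\<^sub>R u)) = (h - 0) *
      (frechet_derivative f (at (x + s *\<^sub>R u + h *\<^sub>R v)) u - frechet_derivative f (at (x + s *\<^sub>R u)) u)"
    proof (rule MVT2[OF \<open>0 < h\<close>])
      fix s assume "0 \<le> s" "s \<le> h"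
      then show "((\<lambda>s. f (x + s *\<^sub>R u + h *\<^sub>R v) - f (x + s *\<^sub>R u)) has_real_derivative
         frechet_derivative f (at (x + s *\<^sub>R u + h *\<^sub>R v)) u - frechet_derivative f (at (x + s *\<^sub>R u)) u) (at s)"
        using S[of s h] S[of s 0] \<open>0 < h\<close>
        by (intro DERIV_diff line[OF f]) (auto intro!: derivative_eq_intros)
    qed
    then show ?thesis using that by blast
  qed
  moreover
  obtain t where t: "0 < t" "t < h" and
    "frechet_derivative f (at (x + s *\<^sub>R u + h *\<^sub>R v)) u - frechet_derivative f (at (x + s *\<^sub>R u + 0 *\<^sub>R v)) u
       = (h - 0) * frechet_derivative (\<lambda>y. frechet_derivative f (at y) u) (at (x + s *\<^sub>R u + t *\<^sub>R v)) v"
  proof -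
    have "\<exists>t>0. t < h \<and> frechet_derivative f (at (x + s *\<^sub>R u + h *\<^sub>R v)) u - frechet_derivative f (at (x + s *\<^sub>R u + 0 *\<^sub>R v)) u
       = (h - 0) * frechet_derivative (\<lambda>y. frechet_derivative f (at y) u) (at (x + s *\<^sub>R u + t *\<^sub>R v)) v"
    proof (rule MVT2[OF \<open>0 < h\<close>])
      fix t assume "0 \<le> t" "t \<le> h"
      then show "((\<lambda>t. frechet_derivative f (at (x + s *\<^sub>R u + t *\<^sub>R v)) u) has_real_derivative
         frechet_derivative (\<lambda>y. frechet_derivative f (at y) u) (at (x + s *\<^sub>R u + t *\<^sub>R v)) v) (at t)"
        using S[of s t] s
        by (intro line[OF smooth_on_deriv[OF f], where c = "\<lambda>t. x + s *\<^sub>R u + t *\<^sub>R v"]) (auto intro!: derivative_eq_intros)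
    qed
    then show ?thesis using that by blast
  qed
  ultimately have "f (x + h *\<^sub>R u + h *\<^sub>R v) - f (x + h *\<^sub>R u) - f (x + h *\<^sub>R v) + f x
      = h\<^sup>2 * frechet_derivative (\<lambda>y. frechet_derivative f (at y) u) (at (x + s *\<^sub>R u + t *\<^sub>R v)) v"
    by (simp add: power2_eq_square algebra_simps)
  with s t show ?thesis using that[of s t] by simp
qed

lemma second_derivative_symmetric_real:
  fixes f :: "'a::euclidean_space \<Rightarrow> real"
  assumes f: "smooth_on S f" and x: "x \<in> S"
  shows "frechet_derivative (\<lambda>y. frechet_derivative f (at y) u) (at x) v
    = frechet_derivative (\<lambda>y. frechet_derivative f (at y) v) (at x) u"
proof -
  define F where "F u v = (\<lambda>y. frechet_derivative (\<lambda>y. frechet_derivative f (at y) u) (at y) v)" for u v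
  have "\<bar>F u v x - F v u x\<bar> < e" if "e > 0" for e
  proof -
    have cont: "continuous_on S (F a b)" for a b
      unfolding F_def by (intro smooth_on_continuous smooth_on_deriv f)
    have "open S" using f by (rule smooth_onD_open)
    have nbhd: "\<forall>\<^sub>F y in nhds x. y \<in> S \<and> \<bar>F a b y - F a b x\<bar> < e / 2" for a b
    proof -
      have "(F a b \<longlongrightarrow> F a b x) (nhds x)"
        using cont \<open>open S\<close> x by (meson continuous_on_eq_continuous_at tendsto_at_iff_tendsto_nhds isCont_def)
      then have "\<forall>\<^sub>F y in nhds x. dist (F a b y) (F a b x) < e / 2"
        using \<open>e > 0\<close> by (intro tendstoD) auto
      then show ?thesis
        using eventually_nhds_in_open[OF \<open>open S\<close> x] by eventually_elim (simp add: dist_real_def)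
    qed
    have "\<forall>\<^sub>F y in nhds x. y \<in> S \<and> \<bar>F u v y - F u v x\<bar> < e / 2 \<and> \<bar>F v u y - F v u x\<bar> < e / 2"
      using nbhd[of u v] nbhd[of v u] by eventually_elim auto
    then obtain d where "d > 0" and d: "\<And>y. dist y x < d \<Longrightarrow> y \<in> S \<and> \<bar>F u v y - F u v x\<bar> < e / 2 \<and> \<bar>F v u y - F v u x\<bar> < e / 2"
      unfolding eventually_nhds_metric by blast
    \<comment> \<open>the parallelogram with sides \<open>h u\<close> and \<open>h v\<close> then lies in the ball of radius \<open>d\<close>\<close>
    define h where "h = d / (norm u + norm v + 1)"
    have pos: "0 < norm u + norm v + 1"
      by (smt (verit) norm_ge_zero)
    have "0 < h" using \<open>d > 0\<close> pos by (simp add: h_def)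
    have near: "dist (x + s *\<^sub>R u + t *\<^sub>R v) x < d" if "0 \<le> s" "s \<le> h" "0 \<le> t" "t \<le> h" for s t
    proof -
      have "dist (x + s *\<^sub>R u + t *\<^sub>R v) x \<le> s * norm u + t * norm v"
        using norm_triangle_ineq[of "s *\<^sub>R u" "t *\<^sub>R v"] that by (simp add: dist_norm add.assoc)
      also have "\<dots> \<le> h * norm u + h * norm v"
        using that by (intro add_mono mult_right_mono) auto
      also have "\<dots> < h * (norm u + norm v + 1)"
        using \<open>0 < h\<close> by (simp add: algebra_simps)
      also have "\<dots> = d" using pos by (simp add: h_def)
      finally show ?thesis .
    qed
    obtain s t where st: "0 \<le> s" "s \<le> h" "0 \<le> t" "t \<le> h" and
      1: "f (x + h *\<^sub>R u + h *\<^sub>R v) - f (x + h *\<^sub>R u) - f (x + h *\<^sub>R v) + f x = h\<^sup>2 * F u v (x + s *\<^sub>R u + t *\<^sub>R v)"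
      unfolding F_def
      by (rule second_difference_mean_value[OF f \<open>0 < h\<close>, of x u v]) (use near d in auto)
    have near': "dist (x + s *\<^sub>R v + t *\<^sub>R u) x < d" if "0 \<le> s" "s \<le> h" "0 \<le> t" "t \<le> h" for s t
      using near[of t s] that by (simp add: add_ac)
    obtain s' t' where st': "0 \<le> s'" "s' \<le> h" "0 \<le> t'" "t' \<le> h" and
      2: "f (x + h *\<^sub>R v + h *\<^sub>R u) - f (x + h *\<^sub>R v) - f (x + h *\<^sub>R u) + f x = h\<^sup>2 * F v u (x + s' *\<^sub>R v + t' *\<^sub>R u)"
      unfolding F_def
      by (rule second_difference_mean_value[OF f \<open>0 < h\<close>, of x v u]) (use near' d in auto)
    have sw: "x + h *\<^sub>R v + h *\<^sub>R u = x + h *\<^sub>R u + h *\<^sub>R v"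
      by (simp add: add_ac)
    have "h\<^sup>2 * F u v (x + s *\<^sub>R u + t *\<^sub>R v) = h\<^sup>2 * F v u (x + s' *\<^sub>R v + t' *\<^sub>R u)"
      using 1 2 unfolding sw by linarith
    then have "F u v (x + s *\<^sub>R u + t *\<^sub>R v) = F v u (x + s' *\<^sub>R v + t' *\<^sub>R u)"
      using \<open>0 < h\<close> by simp
    then show ?thesis
      using d[OF near[OF st]] d[OF near'[OF st']] by linarith
  qed
  then have "F u v x = F v u x"
    by (metis abs_ge_zero less_irrefl zero_less_abs_iff right_minus_eq)
  then show ?thesis by (simp add: F_def)
qed

lemma second_derivative_symmetric:
  fixes f :: "'a::euclidean_space \<Rightarrow> 'b::euclidean_space"
  assumes f: "smooth_on S f" and x: "x \<in> S"
  shows "frechet_derivative (\<lambda>y. frechet_derivative f (at y) u) (at x) v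
    = frechet_derivative (\<lambda>y. frechet_derivative f (at y) v) (at x) u"
proof (rule euclidean_eqI)
  fix b :: 'b assume "b \<in> Basis"
  let ?g = "\<lambda>y. f y \<bullet> b"
  have g: "smooth_on S ?g"
    by (rule smooth_on_linear[OF bounded_linear_inner_left f])
  have "frechet_derivative (\<lambda>y. frechet_derivative f (at y) u) (at x) v \<bullet> b
    = frechet_derivative (\<lambda>y. frechet_derivative ?g (at y) u) (at x) v" for u v
  proof -
    have "frechet_derivative (\<lambda>y. frechet_derivative f (at y) u) (at x) v \<bullet> b
      = frechet_derivative (\<lambda>y. frechet_derivative f (at y) u \<bullet> b) (at x) v"
      by (rule frechet_derivative_linear_compose[OF bounded_linear_inner_left, symmetric])
         (rule smooth_on_differentiable[OF smooth_on_deriv[OF f] x])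
    also have "\<dots> = frechet_derivative (\<lambda>y. frechet_derivative ?g (at y) u) (at x) v"
    proof (rule fun_cong[OF frechet_derivative_transform_within_open])
      show "(\<lambda>y. frechet_derivative f (at y) u \<bullet> b) differentiable at x"
        by (rule smooth_on_differentiable[OF smooth_on_linear[OF bounded_linear_inner_left smooth_on_deriv[OF f]] x])
      show "frechet_derivative f (at y) u \<bullet> b = frechet_derivative ?g (at y) u" if "y \<in> S" for y
        by (rule frechet_derivative_linear_compose[OF bounded_linear_inner_left, symmetric])
           (rule smooth_on_differentiable[OF f that])
    qed (use smooth_onD_open[OF f] x in auto)
    finally show ?thesis .
  qed
  then show "frechet_derivative (\<lambda>y. frechet_derivative f (at y) u) (at x) v \<bullet> b
    = frechet_derivative (\<lambda>y. frechet_derivative f (at y) v) (at x) u \<bullet> b"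
    using second_derivative_symmetric_real[OF g x, of u v] by simp
qed

section \<open>Smoothness of inverse maps\<close>

lemma linear_two_sided_inverse:
  fixes M :: "'a::real_vector \<Rightarrow> 'b::real_vector"
  assumes "linear M" and MN: "\<And>v. M (N v) = v" and NM: "\<And>v. N (M v) = v"
  shows "linear N"
proof -
  interpret linear M by fact
  show ?thesis
  proof (rule linearI)
    show "N (u + w) = N u + N w" for u w
      using NM[of "N u + N w"] by (simp add: add MN)
    show "N (c *\<^sub>R u) = c *\<^sub>R N u" for c u
      using NM[of "c *\<^sub>R N u"] by (simp add: scale MN)
  qed
qed

text \<open>Inverting an operator depending on a parameter is a special case of inverting a map: the
  inverse of \<open>(x, w) \<mapsto> (x, M x w)\<close> is \<open>(x, u) \<mapsto> (x, N x u)\<close>. Thus the derivative of \<open>N\<close> comes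
  from the inverse function theorem, as the familiar \<open>- N M' N\<close>.\<close>

lemma op_inverse_has_derivative:
  fixes M N :: "'a::euclidean_space \<Rightarrow> 'b::euclidean_space \<Rightarrow> 'b"
  assumes "open S" and x: "x \<in> S"
    and lin: "\<And>x. x \<in> S \<Longrightarrow> linear (M x)"
    and M: "\<And>x b. x \<in> S \<Longrightarrow> ((\<lambda>x. M x b) has_derivative M' x b) (at x)"
    and MN: "\<And>x v. x \<in> S \<Longrightarrow> M x (N x v) = v" and NM: "\<And>x v. x \<in> S \<Longrightarrow> N x (M x v) = v"
  shows "((\<lambda>x. N x v) has_derivative
    (\<lambda>h. - N x (\<Sum>b\<in>Basis. (N x v \<bullet> b) *\<^sub>R M' x b h))) (at x)"
proof -
  define Q where "Q x w h = (\<Sum>b\<in>Basis. (w \<bullet> b) *\<^sub>R M' x b h)" for x w h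
  define F where "F = (\<lambda>z. (fst z, \<Sum>b\<in>Basis. (snd z \<bullet> b) *\<^sub>R M (fst z) b))"
  define F' where "F' z = (\<lambda>d. (fst d, Q (fst z) (snd z) (fst d) + M (fst z) (snd d)))" for z
  define G where "G = (\<lambda>z. (fst z, N (fst z) (snd z)))"
  define G' where "G' z = (\<lambda>d. (fst d, N (fst z) (snd d - Q (fst z) (snd z) (fst d))))" for z
  have Msum: "M x w = (\<Sum>b\<in>Basis. (w \<bullet> b) *\<^sub>R M x b)" if "x \<in> S" for x w
  proof -
    interpret linear "M x" using lin[OF that] .
    have "M x w = M x (\<Sum>b\<in>Basis. (w \<bullet> b) *\<^sub>R b)" by (simp add: euclidean_representation)
    then show ?thesis by (simp only: sum scale)
  qed
  have Nlin: "linear (N x)"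
    by (rule linear_two_sided_inverse[OF lin[OF x] MN[OF x] NM[OF x]])
  have FM: "F z = (fst z, M (fst z) (snd z))" if "fst z \<in> S" for z
    unfolding F_def by (subst Msum[OF that]) simp
  have dF: "(F has_derivative F' z) (at z)" if "z \<in> S \<times> UNIV" for z
  proof -
    from that have zS: "fst z \<in> S" by auto
    have F': "F' z = (\<lambda>d. (fst d, \<Sum>b\<in>Basis. (snd z \<bullet> b) *\<^sub>R M' (fst z) b (fst d)
        + (snd d \<bullet> b) *\<^sub>R M (fst z) b))"
      unfolding F'_def Q_def by (rule ext, subst Msum[OF zS]) (simp add: sum.distrib)
    have "((\<lambda>z. M (fst z) b) has_derivative (\<lambda>d. M' (fst z) b (fst d))) (at z)" for b
      using diff_chain_at[OF has_derivative_fst[OF has_derivative_ident] M[OF zS, of b]] by (simp add: o_def)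
    then show ?thesis
      unfolding F_def F' by (auto intro!: derivative_eq_intros)
  qed
  define z where "z = (x, N x v)"
  have "(G has_derivative G' z) (at (F z))"
  proof (rule has_derivative_inverse_on[where S = "S \<times> UNIV" and f = F and f' = F' and g' = G'])
    show "open (S \<times> (UNIV :: 'b set))" using \<open>open S\<close> by (simp add: open_Times)
    show "G (F y) = y" if "y \<in> S \<times> UNIV" for y
      using that FM[of y] NM by (auto simp: G_def)
    show "F' z \<circ> G' z = id"
      using x by (auto simp: fun_eq_iff F'_def G'_def z_def MN)
    show "z \<in> S \<times> UNIV" using x by (simp add: z_def)
  qed (rule dF)
  moreover have "F z = (x, v)"
    using FM[of z] x by (simp add: z_def MN)
  ultimately have "(G has_derivative G' z) (at (x, v))" by simp
  from diff_chain_at[OF has_derivative_Pair[OF has_derivative_ident has_derivative_const] this]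
  have "((\<lambda>y. (y, N y v)) has_derivative (\<lambda>h. G' z (h, 0))) (at x)"
    by (simp add: o_def G_def)
  from has_derivative_snd[OF this]
  show ?thesis
    by (simp add: G'_def z_def Q_def linear_neg[OF Nlin])
qed

lemma smooth_on_op_inverse:
  fixes M N :: "'a::euclidean_space \<Rightarrow> 'b::euclidean_space \<Rightarrow> 'b"
  assumes "open S"
    and lin: "\<And>x. x \<in> S \<Longrightarrow> linear (M x)"
    and M: "\<And>v. smooth_on S (\<lambda>x. M x v)"
    and MN: "\<And>x v. x \<in> S \<Longrightarrow> M x (N x v) = v" and NM: "\<And>x v. x \<in> S \<Longrightarrow> N x (M x v) = v"
  shows "smooth_on S (\<lambda>x. N x v)"
proof -
  define M' where "M' x b = frechet_derivative (\<lambda>x. M x b) (at x)" for x b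
  have M': "((\<lambda>x. M x b) has_derivative M' x b) (at x)" if "x \<in> S" for x b
    unfolding M'_def by (rule smooth_on_has_derivative[OF M that])
  have Nsum: "N x w = (\<Sum>b\<in>Basis. (w \<bullet> b) *\<^sub>R N x b)" if "x \<in> S" for x w
  proof -
    interpret linear "M x" using lin[OF that] .
    have "M x (\<Sum>b\<in>Basis. (w \<bullet> b) *\<^sub>R N x b) = w"
      by (simp add: sum scale MN[OF that] euclidean_representation)
    then show ?thesis using NM[OF that, of "\<Sum>b\<in>Basis. (w \<bullet> b) *\<^sub>R N x b"] by simp
  qed
  have d: "((\<lambda>x. N x v) has_derivative
      (\<lambda>h. - N x (\<Sum>b\<in>Basis. (N x v \<bullet> b) *\<^sub>R M' x b h))) (at x)" if "x \<in> S" for x v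
    using op_inverse_has_derivative[OF assms(1) that lin M' MN NM] .
  have "Ck_on n S (\<lambda>x. N x v)" for n v
  proof (induction n arbitrary: v)
    case 0
    show ?case
      using d by (auto intro!: continuous_at_imp_continuous_on intro: has_derivative_continuous)
  next
    case (Suc n)
    show ?case
    proof (rule Ck_on_SucI[OF assms(1)])
      show "((\<lambda>x. N x v) has_derivative (\<lambda>h. - (\<Sum>c\<in>Basis.
          ((\<Sum>b\<in>Basis. (N x v \<bullet> b) *\<^sub>R M' x b h) \<bullet> c) *\<^sub>R N x c))) (at x)" if "x \<in> S" for x
        using d[OF that, of v] by (subst (asm) Nsum[OF that])
      fix h
      have "Ck_on n S (\<lambda>x. M' x b h)" for b
        using smooth_on_deriv[OF M, of b h] unfolding M'_def smooth_on_def by blast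
      then have "Ck_on n S (\<lambda>x. \<Sum>b\<in>Basis. (N x v \<bullet> b) *\<^sub>R M' x b h)"
        using Ck_on_linear[OF assms(1) bounded_linear_inner_left Suc.IH]
        by (intro Ck_on_sum Ck_on_bilinear[OF _ bounded_bilinear_scaleR] assms(1))
      from Ck_on_linear[OF assms(1) bounded_linear_inner_left this]
      have "Ck_on n S (\<lambda>x. \<Sum>c\<in>Basis. ((\<Sum>b\<in>Basis. (N x v \<bullet> b) *\<^sub>R M' x b h) \<bullet> c) *\<^sub>R N x c)"
        using Suc.IH by (intro Ck_on_sum Ck_on_bilinear[OF _ bounded_bilinear_scaleR] assms(1))
      then show "Ck_on n S (\<lambda>x. - (\<Sum>c\<in>Basis. ((\<Sum>b\<in>Basis. (N x v \<bullet> b) *\<^sub>R M' x b h) \<bullet> c) *\<^sub>R N x c))"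
        by (rule Ck_on_linear[OF assms(1) bounded_linear_minus[OF bounded_linear_ident]])
    qed
  qed
  then show ?thesis using assms(1) by (simp add: smooth_on_def)
qed

text \<open>The derivative of the inverse \<open>g\<close> is \<open>N \<circ> g\<close>, where \<open>N x\<close> is the inverse of the derivative of \<open>f\<close>
  at \<open>x\<close>. Since \<open>N\<close> is smooth, \<open>g\<close> inherits one more order of differentiability from itself at
  each step.\<close>

lemma smooth_inverse:
  fixes f :: "'a::euclidean_space \<Rightarrow> 'a"
  assumes f: "smooth_on V f" and inj: "inj_on f V"
    and inj': "\<And>x. x \<in> V \<Longrightarrow> inj (frechet_derivative f (at x))"
  shows "diffeo_onto_image V f"
    and "x \<in> V \<Longrightarrow> (inv_into V f has_derivative inv (frechet_derivative f (at x))) (at (f x))"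
proof -
  define g where "g = inv_into V f"
  define N where "N x = inv (frechet_derivative f (at x))" for x
  have V: "open V" using f by (rule smooth_onD_open)
  have lin: "linear (frechet_derivative f (at x))" if "x \<in> V" for x
    using smooth_on_differentiable[OF f that] by (rule linear_frechet_derivative)
  have NM: "N x (frechet_derivative f (at x) v) = v" if "x \<in> V" for x v
    using inj'[OF that] by (simp add: N_def)
  have MN: "frechet_derivative f (at x) (N x v) = v" if "x \<in> V" for x v
    using linear_injective_imp_surjective[OF lin[OF that] inj'[OF that]]
    by (simp add: N_def surj_f_inv_f)
  have openim: "open (f ` V)"
    using invariance_of_domain[OF smooth_on_continuous[OF f] V inj] .
  have gf: "g (f x) = x" if "x \<in> V" for x
    using inj that by (simp add: g_def)
  have gV: "g ` (f ` V) \<subseteq> V" using gf by auto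
  have dg: "(g has_derivative N x) (at (f x))" if "x \<in> V" for x
  proof (rule has_derivative_inverse_on[where f' = "\<lambda>x. frechet_derivative f (at x)" and g' = N and f = f and g = g, OF V _ gf _ that])
    show "(f has_derivative frechet_derivative f (at y)) (at y)" if "y \<in> V" for y
      by (rule smooth_on_has_derivative[OF f that])
    show "frechet_derivative f (at x) \<circ> N x = id"
      using MN[OF that] by (simp add: fun_eq_iff)
  qed
  then show "x \<in> V \<Longrightarrow> (inv_into V f has_derivative inv (frechet_derivative f (at x))) (at (f x))"
    by (simp add: g_def N_def)
  have N: "smooth_on V (\<lambda>x. N x v)" for v
    by (rule smooth_on_op_inverse[OF V lin smooth_on_deriv[OF f] MN NM])
  have "Ck_on n (f ` V) g" for n
  proof (induction n)
    case 0
    show ?case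
      using dg by (auto intro!: continuous_at_imp_continuous_on intro: has_derivative_continuous)
  next
    case (Suc n)
    show ?case
    proof (rule Ck_on_SucI[OF openim])
      show "(g has_derivative N (g y)) (at y)" if "y \<in> f ` V" for y
        using that dg gf by auto
      show "Ck_on n (f ` V) (\<lambda>y. N (g y) v)" for v
        using N[of v] by (intro Ck_on_compose[OF openim gV Suc]) (simp add: smooth_on_def)
    qed
  qed
  then show "diffeo_onto_image V f"
    using f inj openim by (simp add: diffeo_onto_image_def smooth_on_def g_def)
qed

section \<open>The Legendre transform of a function with positive definite Hessian\<close>

lemma grad_has_derivative_hess:
  assumes "smooth_on S f" "x \<in> S"
  shows "(grad f has_derivative hess f x) (at x)"
  unfolding hess_def by (rule smooth_on_has_derivative[OF smooth_on_grad[OF assms(1)] assms(2)])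

lemma symmetric_hess:
  fixes f :: "'a::euclidean_space \<Rightarrow> real"
  assumes f: "smooth_on S f" and x: "x \<in> S"
  shows "symmetric_op (hess f x)"
  unfolding symmetric_op_def
proof (intro conjI allI)
  show "linear (hess f x)"
    using grad_has_derivative_hess[OF assms] has_derivative_linear by blast
  have *: "hess f x v \<bullet> w = frechet_derivative (\<lambda>y. frechet_derivative f (at y) w) (at x) v" for v w
  proof -
    have "((\<lambda>y. grad f y \<bullet> w) has_derivative (\<lambda>v. hess f x v \<bullet> w)) (at x)"
      by (rule has_derivative_inner_left[OF grad_has_derivative_hess[OF assms]])
    then have "((\<lambda>y. frechet_derivative f (at y) w) has_derivative (\<lambda>v. hess f x v \<bullet> w)) (at x)"
      by (rule has_derivative_transform_within_open[OF _ smooth_onD_open[OF f] x])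
         (simp add: frechet_derivative_eq_grad smooth_on_differentiable[OF f])
    from fun_cong[OF frechet_derivative_at[OF this]] show ?thesis by simp
  qed
  show "hess f x v \<bullet> w = v \<bullet> hess f x w" for v w
    using second_derivative_symmetric[OF assms, of w v] by (simp add: * inner_commute[of v])
qed

lemma pos_def_op_inj:
  assumes "pos_def_op M"
  shows "inj M"
proof -
  have "linear M" "\<And>v. v \<noteq> 0 \<Longrightarrow> 0 < M v \<bullet> v"
    using assms by (auto simp: pos_def_op_def)
  then show ?thesis
    by (metis linear_injective_0 inner_zero_left less_irrefl)
qed

lemma pos_def_op_inv:
  assumes "symmetric_op M" "pos_def_op M"
  shows "symmetric_op (inv M)" "pos_def_op (inv M)"
proof -
  have lin: "linear M" using assms by (simp add: symmetric_op_def)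
  have inj: "inj M" using assms by (simp add: pos_def_op_inj)
  have MN: "M (inv M v) = v" for v
    using linear_injective_imp_surjective[OF lin inj] by (simp add: surj_f_inv_f)
  have lin': "linear (inv M)"
    using inj by (intro linear_two_sided_inverse[OF lin MN]) simp
  have "inv M v \<bullet> w = v \<bullet> inv M w" for v w
    using assms(1) MN by (metis symmetric_op_def)
  then show "symmetric_op (inv M)" using lin' by (simp add: symmetric_op_def)
  have "0 < inv M v \<bullet> v" if "v \<noteq> 0" for v
  proof -
    have "inv M v \<noteq> 0" using MN[of v] that linear_0[OF lin] by metis
    then have "0 < M (inv M v) \<bullet> inv M v" using assms(2) by (simp add: pos_def_op_def)
    then show ?thesis by (simp add: MN inner_commute)
  qed
  then show "pos_def_op (inv M)" using lin' by (simp add: pos_def_op_def)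
qed

text \<open>Along a segment the directional derivative has positive derivative, so that
  \<open>(grad f y - grad f x) \<bullet> (y - x) > 0\<close>.\<close>

lemma grad_inj_on_convex:
  fixes f :: "'a::euclidean_space \<Rightarrow> real"
  assumes f: "smooth_on S f" and C: "convex C" "C \<subseteq> S"
    and pos: "\<And>x. x \<in> C \<Longrightarrow> pos_def_op (hess f x)"
  shows "inj_on (grad f) C"
proof (rule inj_onI, rule ccontr)
  fix x y assume x: "x \<in> C" and y: "y \<in> C" and eq: "grad f x = grad f y" and ne: "x \<noteq> y"
  define c where "c t = x + t *\<^sub>R (y - x)" for t :: real
  have c: "c t \<in> C" if "0 \<le> t" "t \<le> 1" for t
    using convexD_alt[OF C(1) x y that] by (simp add: c_def algebra_simps)
  have "grad f (c 0) \<bullet> (y - x) < grad f (c 1) \<bullet> (y - x)"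
  proof (rule DERIV_pos_imp_increasing[OF zero_less_one])
    fix t :: real assume "0 \<le> t" "t \<le> 1"
    then have ct: "c t \<in> C" by (rule c)
    have lin: "linear (hess f (c t))" using pos[OF ct] by (simp add: pos_def_op_def)
    have "(c has_derivative (\<lambda>h. h *\<^sub>R (y - x))) (at t)"
      unfolding c_def by (auto intro!: derivative_eq_intros)
    from diff_chain_at[OF this grad_has_derivative_hess[OF f]] ct C(2)
    have "((\<lambda>t. grad f (c t)) has_derivative (\<lambda>h. h *\<^sub>R hess f (c t) (y - x))) (at t)"
      by (auto simp: o_def linear_scale[OF lin])
    from has_derivative_inner_left[OF this, of "y - x"]
    have "((\<lambda>t. grad f (c t) \<bullet> (y - x)) has_real_derivative (hess f (c t) (y - x) \<bullet> (y - x))) (at t)"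
      by (simp add: has_field_derivative_def mult_commute_abs)
    moreover have "0 < hess f (c t) (y - x) \<bullet> (y - x)"
      using pos[OF ct] ne by (simp add: pos_def_op_def)
    ultimately show "\<exists>d. ((\<lambda>t. grad f (c t) \<bullet> (y - x)) has_real_derivative d) (at t) \<and> 0 < d"
      by blast
  qed
  then show False using eq by (simp add: c_def)
qed

text \<open>On a set where the gradient of \<open>f\<close> is injective, its inverse is the gradient of the Legendre
  transform. This makes the two Hessians inverse to each other.\<close>

context
  fixes f :: "state \<Rightarrow> real" and V :: "state set"
  assumes f: "smooth_on V f" and pos: "\<And>q. q \<in> V \<Longrightarrow> pos_def_op (hess f q)"
    and inj: "inj_on (grad f) V"
begin

lemma grad_diffeo:
  "diffeo_onto_image V (grad f)"
  "q \<in> V \<Longrightarrow> (inv_into V (grad f) has_derivative inv (hess f q)) (at (grad f q))"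
  using smooth_inverse[OF smooth_on_grad[OF f] inj] pos_def_op_inj[OF pos]
  by (simp_all add: hess_def)

lemma smooth_on_inv_grad: "smooth_on (grad f ` V) (inv_into V (grad f))"
  using grad_diffeo(1) by (simp add: diffeo_onto_image_def)

lemma smooth_on_legendre_potential: "smooth_on (grad f ` V) (legendre_potential V f)"
proof -
  have "smooth_on (grad f ` V) (\<lambda>p. inv_into V (grad f) p \<bullet> p - f (inv_into V (grad f) p))"
    using smooth_on_inv_grad smooth_onD_open[OF smooth_on_inv_grad]
    by (intro smooth_on_diff smooth_on_bilinear[OF bounded_bilinear_inner] smooth_on_ident
        smooth_on_compose[OF _ f]) (auto simp: inv_into_into)
  then show ?thesis
    by (rule smooth_on_cong) (simp add: legendre_potential_def Let_def)
qed

text \<open>In \<open>d(q \<bullet> p - f q) = q \<bullet> dp + (p - grad f q) \<bullet> dq\<close> the last term vanishes.\<close>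

lemma grad_legendre_potential:
  assumes q: "q \<in> V"
  shows "grad (legendre_potential V f) (grad f q) = q"
proof (rule grad_eqI)
  let ?g = "inv_into V (grad f)"
  have gq: "?g (grad f q) = q" using inj q by simp
  note dg = grad_diffeo(2)[OF q]
  have df: "(f has_derivative (\<lambda>v. grad f q \<bullet> v)) (at (?g (grad f q)))"
    unfolding gq by (rule has_derivative_grad[OF smooth_on_differentiable[OF f q]])
  have "((\<lambda>p. ?g p \<bullet> p - f (?g p)) has_derivative
      (\<lambda>v. (q \<bullet> v + inv (hess f q) v \<bullet> grad f q) - grad f q \<bullet> inv (hess f q) v)) (at (grad f q))"
    using has_derivative_diff[OF has_derivative_inner[OF dg has_derivative_ident] diff_chain_at[OF dg df]]
    by (simp add: o_def gq)
  then show "(legendre_potential V f has_derivative (\<lambda>v. q \<bullet> v)) (at (grad f q))"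
    by (simp add: legendre_potential_def[abs_def] Let_def inner_commute)
qed

lemma hess_legendre_potential:
  assumes q: "q \<in> V"
  shows "hess (legendre_potential V f) (grad f q) = inv (hess f q)"
proof -
  have "(grad (legendre_potential V f) has_derivative inv (hess f q)) (at (grad f q))"
  proof (rule has_derivative_transform_within_open[OF grad_diffeo(2)[OF q]])
    show "open (grad f ` V)" using smooth_on_inv_grad by (rule smooth_onD_open)
    show "inv_into V (grad f) p = grad (legendre_potential V f) p" if "p \<in> grad f ` V" for p
      using that inj by (auto simp: grad_legendre_potential)
  qed (use q in auto)
  from frechet_derivative_at[OF this] show ?thesis by (simp add: hess_def)
qed

lemma hess_legendre_potential_pos_def:
  assumes "p \<in> grad f ` V"
  shows "symmetric_op (hess (legendre_potential V f) p)" "pos_def_op (hess (legendre_potential V f) p)"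
  using assms pos_def_op_inv[OF symmetric_hess[OF f] pos] by (auto simp: hess_legendre_potential)

end

section \<open>The first-order system and its energy\<close>

lemma dt_linear:
  "bounded_linear h \<Longrightarrow> f differentiable (at X) \<Longrightarrow> dt (\<lambda>Y. h (f Y)) X = h (dt f X)"
  unfolding dt_def by (rule frechet_derivative_linear_compose)

lemma dx_linear:
  "bounded_linear h \<Longrightarrow> f differentiable (at X) \<Longrightarrow> dx k (\<lambda>Y. h (f Y)) X = h (dx k f X)"
  unfolding dx_def by (rule frechet_derivative_linear_compose)

lemmas component_defs = B_of_def phi_of_def D_of_def psi_of_def

lemma bounded_linear_components:
  "bounded_linear (\<lambda>q. B_of q $ k)" "bounded_linear phi_of"
  "bounded_linear (\<lambda>q. D_of q $ k)" "bounded_linear psi_of"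
  "bounded_linear B_of" "bounded_linear D_of"
  unfolding linear_conv_bounded_linear[symmetric]
  by (rule linearI; simp add: component_defs)+

lemma H_op_eq:
  "H_op k p = (cross3 (axis k 1) (D_of p) + phi_of p *\<^sub>R axis k 1, B_of p $ k,
     - cross3 (axis k 1) (B_of p) + psi_of p *\<^sub>R axis k 1, D_of p $ k)"
  by (cases p) (simp add: component_defs)

lemma linear_H_op: "linear (H_op k)"
  by (rule linearI)
     (simp_all add: H_op_eq component_defs cross3_simps scaleR_vec_def)

lemma symmetric_H_op: "symmetric_op (H_op k)"
  unfolding symmetric_op_def
proof (intro conjI allI linear_H_op)
  fix v w
  show "H_op k v \<bullet> w = v \<bullet> H_op k w"
    using exhaust_3[of k]
    by (elim disjE) (simp_all add: H_op_eq component_defs inner_prod_def cross3_simps axis_def)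
qed

lemma system_eq_H_op_form:
  fixes Q :: state and P :: "3 \<Rightarrow> state"
  shows "(\<forall>k. B_of Q $ k + (\<Sum>i\<in>UNIV. \<Sum>j\<in>UNIV. eps k i j * D_of (P i) $ j) + phi_of (P k) = 0) \<and>
    phi_of Q + (\<Sum>k\<in>UNIV. B_of (P k) $ k) = 0 \<and>
    (\<forall>k. D_of Q $ k - (\<Sum>i\<in>UNIV. \<Sum>j\<in>UNIV. eps k i j * B_of (P i) $ j) + psi_of (P k) = 0) \<and>
    psi_of Q + (\<Sum>k\<in>UNIV. D_of (P k) $ k) = 0
    \<longleftrightarrow> Q + (\<Sum>k\<in>UNIV. H_op k (P k)) = 0"
  by (simp add: H_op_eq component_defs prod_eq_iff sum_3 forall_3 eps_def cross3_simps axis_def)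

text \<open>Taking a component is linear, hence commutes with \<open>\<partial>\<^sub>t\<close> and \<open>\<partial>\<^sub>k\<close>, so that the equations
  assemble into one for the state; the curls come from \<open>(\<Sum>k. e\<^sub>k \<times> \<partial>\<^sub>kd)\<close>.\<close>

lemma smooth_solution_iff:
  assumes E: "smooth_on W \<E>" and q: "smooth_on \<Omega> q" "q ` \<Omega> \<subseteq> W"
  shows "smooth_solution W \<E> \<Omega> q \<longleftrightarrow>
    (\<forall>X\<in>\<Omega>. dt q X + (\<Sum>k\<in>UNIV. H_op k (dx k (\<lambda>Y. grad \<E> (q Y)) X)) = 0)"
proof -
  have "smooth_on \<Omega> (\<lambda>Y. grad \<E> (q Y))"
    by (rule smooth_on_compose[OF q(1) smooth_on_grad[OF E] q(2)])
  note d = smooth_on_differentiable[OF this] smooth_on_differentiable[OF q(1)]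
  note lin = bounded_linear_components
  show ?thesis
    unfolding smooth_solution_def system_eq_H_op_form[symmetric]
    using q by (simp add: d dt_linear[OF lin(1)] dt_linear[OF lin(2)] dt_linear[OF lin(3)] dt_linear[OF lin(4)]
        dx_linear[OF lin(1)] dx_linear[OF lin(2)] dx_linear[OF lin(3)] dx_linear[OF lin(4)])
qed

text \<open>The Poynting-type flux is the quadratic form of the operator \<open>H\<^sub>k\<close>, which is why the
  symmetry of \<open>H\<^sub>k\<close> yields a conservation law.\<close>

lemma energy_flux_eq: "energy_flux k p = (p \<bullet> H_op k p) / 2"
  using exhaust_3[of k]
  by (elim disjE) (simp_all add: energy_flux_def H_op_eq component_defs inner_prod_def eps_def cross3_simps axis_def)

lemma dx_energy_flux:
  assumes "p differentiable (at X)"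
  shows "dx k (\<lambda>Y. energy_flux k (p Y)) X = p X \<bullet> H_op k (dx k p X)"
proof -
  have bl: "bounded_linear (H_op k)"
    using linear_H_op linear_conv_bounded_linear by blast
  have dp: "(p has_derivative frechet_derivative p (at X)) (at X)"
    using assms by (simp add: frechet_derivative_works)
  have sym: "H_op k v \<bullet> w = v \<bullet> H_op k w" for v w
    using symmetric_H_op[of k] unfolding symmetric_op_def by blast
  have "((\<lambda>Y. (p Y \<bullet> H_op k (p Y)) / 2) has_derivative (\<lambda>v. (p X \<bullet> H_op k (frechet_derivative p (at X) v)
      + frechet_derivative p (at X) v \<bullet> H_op k (p X)) / 2)) (at X)"
    using bounded_linear.has_derivative[OF bounded_linear_divide[of 2]
      has_derivative_inner[OF dp bounded_linear.has_derivative[OF bl dp]]] by simp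
  from fun_cong[OF frechet_derivative_at[OF this], of "(0, axis k 1)"]
  show ?thesis
    by (simp add: dx_def energy_flux_eq sym[symmetric] inner_commute[of _ "p X"])
qed

text \<open>Pairing the system with the dual state \<open>p = grad \<E> q\<close> turns \<open>\<partial>\<^sub>tq\<close> into \<open>\<partial>\<^sub>t\<E>\<close>, and, as the
  operators \<open>H\<^sub>k\<close> are constant and symmetric, \<open>p \<bullet> H\<^sub>k \<partial>\<^sub>kp\<close> into the derivative of \<open>(p \<bullet> H\<^sub>k p) / 2\<close>.\<close>

lemma energy_conservation_of_solution:
  assumes E: "smooth_on W \<E>" and sol: "smooth_solution W \<E> \<Omega> q"
  shows "energy_conservation \<E> \<Omega> q"
  unfolding energy_conservation_def
proof
  fix X assume X: "X \<in> \<Omega>"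
  have q: "smooth_on \<Omega> q" "q ` \<Omega> \<subseteq> W" using sol by (auto simp: smooth_solution_def)
  define p where "p Y = grad \<E> (q Y)" for Y
  have p: "smooth_on \<Omega> p"
    unfolding p_def by (rule smooth_on_compose[OF q(1) smooth_on_grad[OF E] q(2)])
  have "(\<E> has_derivative (\<lambda>v. p X \<bullet> v)) (at (q X))"
    unfolding p_def using q(2) X by (intro has_derivative_grad smooth_on_differentiable[OF E]) auto
  from diff_chain_at[OF smooth_on_has_derivative[OF q(1) X] this]
  have "((\<lambda>Y. \<E> (q Y)) has_derivative (\<lambda>v. p X \<bullet> frechet_derivative q (at X) v)) (at X)"
    by (simp add: o_def)
  from fun_cong[OF frechet_derivative_at[OF this]]
  have dtE: "dt (\<lambda>Y. \<E> (q Y)) X = p X \<bullet> dt q X" by (simp add: dt_def)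
  have "dt (\<lambda>Y. \<E> (q Y)) X + (\<Sum>k\<in>UNIV. dx k (\<lambda>Y. energy_flux k (p Y)) X)
    = p X \<bullet> (dt q X + (\<Sum>k\<in>UNIV. H_op k (dx k p X)))"
    using dtE dx_energy_flux[OF smooth_on_differentiable[OF p X]]
    by (simp add: inner_add_right inner_sum_right)
  also have "\<dots> = 0"
    using sol X unfolding smooth_solution_iff[OF E q] p_def by simp
  finally show "dt (\<lambda>Y. \<E> (q Y)) X + (\<Sum>k\<in>UNIV. dx k (\<lambda>Y. energy_flux k (grad \<E> (q Y))) X) = 0"
    by (simp add: p_def)
qed

text \<open>The Hessian of the Legendre transform inverts that of \<open>\<E>\<close>, so it takes \<open>\<partial>\<^sub>tp\<close> back to \<open>\<partial>\<^sub>tq\<close>.\<close>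

lemma smooth_solution_iff_quasilinear:
  assumes E: "smooth_on W \<E>" and V: "open V" "V \<subseteq> W"
    and pos: "\<And>q. q \<in> V \<Longrightarrow> pos_def_op (hess \<E> q)" and inj: "inj_on (grad \<E>) V"
    and q: "smooth_on \<Omega> q" "q ` \<Omega> \<subseteq> V"
  shows "smooth_solution W \<E> \<Omega> q \<longleftrightarrow>
    satisfies_quasilinear (hess (legendre_potential V \<E>)) H_op \<Omega> (\<lambda>X. grad \<E> (q X))"
proof -
  have EV: "smooth_on V \<E>" by (rule smooth_on_subset[OF E V(2,1)])
  have "hess (legendre_potential V \<E>) (grad \<E> (q X)) (dt (\<lambda>Y. grad \<E> (q Y)) X) = dt q X"
    if X: "X \<in> \<Omega>" for X
  proof -
    have qX: "q X \<in> V" using q(2) X by auto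
    have "((\<lambda>Y. grad \<E> (q Y)) has_derivative (\<lambda>v. hess \<E> (q X) (frechet_derivative q (at X) v))) (at X)"
      using diff_chain_at[OF smooth_on_has_derivative[OF q(1) X] grad_has_derivative_hess[OF EV qX]]
      by (simp add: o_def)
    from fun_cong[OF frechet_derivative_at[OF this]]
    have "dt (\<lambda>Y. grad \<E> (q Y)) X = hess \<E> (q X) (dt q X)" by (simp add: dt_def)
    then show ?thesis
      using hess_legendre_potential[OF EV pos inj qX] pos_def_op_inj[OF pos[OF qX]] by simp
  qed
  then show ?thesis
    using smooth_solution_iff[OF E q(1)] q(2) V(2) by (auto simp: satisfies_quasilinear_def)
qed

section \<open>The partial Legendre transform and the Euler--Lagrange equations\<close>

lemma legendre_map_eq_grad:
  assumes "smooth_on UNIV L"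
  shows "legendre_map L B \<psi> (E, \<phi>) =
    (fst (grad L (E, B, \<phi>, \<psi>)), fst (snd (snd (grad L (E, B, \<phi>, \<psi>)))))"
  unfolding legendre_map_def
proof (rule grad_eqI)
  have "((\<lambda>z::(real^3) \<times> real. (fst z, B, snd z, \<psi>)) has_derivative (\<lambda>v. (fst v, 0, snd v, 0))) (at (E, \<phi>))"
    by (auto intro!: derivative_eq_intros)
  moreover have "(L has_derivative (\<lambda>v. grad L (E, B, \<phi>, \<psi>) \<bullet> v)) (at (fst (E, \<phi>), B, snd (E, \<phi>), \<psi>))"
    using has_derivative_grad[OF smooth_on_differentiable[OF assms UNIV_I]] by simp
  ultimately have "(L \<circ> (\<lambda>z::(real^3) \<times> real. (fst z, B, snd z, \<psi>)) has_derivative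
      (\<lambda>v. grad L (E, B, \<phi>, \<psi>) \<bullet> v) \<circ> (\<lambda>v. (fst v, 0, snd v, 0))) (at (E, \<phi>))"
    by (rule diff_chain_at)
  then show "((\<lambda>(E, \<phi>). L (E, B, \<phi>, \<psi>)) has_derivative (\<lambda>v.
      (fst (grad L (E, B, \<phi>, \<psi>)), fst (snd (snd (grad L (E, B, \<phi>, \<psi>))))) \<bullet> v)) (at (E, \<phi>))"
    by (simp add: o_def case_prod_unfold inner_prod_def)
qed

text \<open>The pair \<open>(E, \<phi>')\<close> whose conjugate momenta are the \<open>D\<close> and \<open>\<phi>\<close> of the given state.\<close>

definition conjugate_vars :: "(lag_vars \<Rightarrow> real) \<Rightarrow> state \<Rightarrow> (real^3) \<times> real" where
  "conjugate_vars L q = inv (legendre_map L (B_of q) (psi_of q)) (D_of q, phi_of q)"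

definition lag_of :: "(lag_vars \<Rightarrow> real) \<Rightarrow> state \<Rightarrow> lag_vars" where
  "lag_of L q = (fst (conjugate_vars L q), B_of q, snd (conjugate_vars L q), psi_of q)"

lemma energy_eq:
  "energy L q = fst (conjugate_vars L q) \<bullet> D_of q + snd (conjugate_vars L q) * phi_of q - L (lag_of L q)"
  by (cases q) (simp add: conjugate_vars_def lag_of_def component_defs Let_def case_prod_unfold)

lemma smooth_on_conjugate_vars:
  assumes "partial_legendre_well_defined L"
  shows "smooth_on (legendre_domain L) (conjugate_vars L)"
proof -
  have "conjugate_vars L = (\<lambda>(B, \<phi>, D, \<psi>). inv (legendre_map L B \<psi>) (D, \<phi>))"
    by (auto simp: conjugate_vars_def component_defs fun_eq_iff)
  then show ?thesis using assms by (simp add: partial_legendre_well_defined_def)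
qed

lemma smooth_on_lag_of:
  assumes "partial_legendre_well_defined L"
  shows "smooth_on (legendre_domain L) (lag_of L)"
proof -
  note c = smooth_on_conjugate_vars[OF assms]
  note o = smooth_on_ident[OF smooth_onD_open[OF c]]
  have "smooth_on (legendre_domain L)
      (\<lambda>q. (fst (conjugate_vars L q), B_of q, snd (conjugate_vars L q), psi_of q))"
    by (intro smooth_on_Pair smooth_on_linear[OF bounded_linear_fst c] smooth_on_linear[OF bounded_linear_snd c]
        smooth_on_linear[OF _ o] bounded_linear_components)
  then show ?thesis by (rule smooth_on_cong) (simp add: lag_of_def)
qed

lemma smooth_on_energy:
  assumes L: "smooth_on UNIV L" and "partial_legendre_well_defined L"
  shows "smooth_on (legendre_domain L) (energy L)"
proof -
  note c = smooth_on_conjugate_vars[OF assms(2)]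
  note o = smooth_on_ident[OF smooth_onD_open[OF c]]
  have "smooth_on (legendre_domain L) (\<lambda>q. fst (conjugate_vars L q) \<bullet> D_of q
      + snd (conjugate_vars L q) * phi_of q - L (lag_of L q))"
    by (intro smooth_on_diff smooth_on_add smooth_on_bilinear[OF bounded_bilinear_inner]
        smooth_on_bilinear[OF bounded_bilinear_mult] smooth_on_linear[OF bounded_linear_fst c]
        smooth_on_linear[OF bounded_linear_snd c] smooth_on_linear[OF _ o] bounded_linear_components
        smooth_on_compose[OF smooth_on_lag_of[OF assms(2)] L] subset_UNIV)
  then show ?thesis by (rule smooth_on_cong) (simp add: energy_eq)
qed

text \<open>The variation of \<open>(E, \<phi>')\<close> with the state drops out of \<open>d\<E>\<close>, because \<open>D = L\<^sub>E\<close> and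
  \<open>\<phi> = L\<^sub>\<phi>\<close> there. What remains is \<open>\<E>\<^sub>D = E\<close>, \<open>\<E>\<^sub>\<phi> = \<phi>'\<close>, \<open>\<E>\<^sub>B = - L\<^sub>B\<close>, \<open>\<E>\<^sub>\<psi> = - L\<^sub>\<psi>\<close>.\<close>

lemma grad_energy:
  assumes L: "smooth_on UNIV L" and wd: "partial_legendre_well_defined L" and q: "q \<in> legendre_domain L"
  shows "grad (energy L) q = (- fst (snd (grad L (lag_of L q))), snd (conjugate_vars L q),
    fst (conjugate_vars L q), - snd (snd (snd (grad L (lag_of L q)))))"
proof (rule grad_eqI)
  define c where "c = conjugate_vars L q"
  define c' where "c' = frechet_derivative (conjugate_vars L) (at q)"
  define g where "g = grad L (lag_of L q)"
  have "legendre_map L (B_of q) (psi_of q) c = (D_of q, phi_of q)"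
  proof -
    have "(D_of q, phi_of q) \<in> range (legendre_map L (B_of q) (psi_of q))"
      using q by (cases q) (simp add: legendre_domain_def component_defs)
    then show ?thesis unfolding c_def conjugate_vars_def by (rule f_inv_into_f)
  qed
  then have Dphi: "D_of q = fst g" "phi_of q = fst (snd (snd g))"
    by (cases c, simp add: legendre_map_eq_grad[OF L] g_def lag_of_def c_def[symmetric])+
  have dc: "(conjugate_vars L has_derivative c') (at q)"
    unfolding c'_def by (rule smooth_on_has_derivative[OF smooth_on_conjugate_vars[OF wd] q])
  note dlin = bounded_linear.has_derivative[OF _ has_derivative_ident]
  note comp = bounded_linear_components
  have "(lag_of L has_derivative (\<lambda>v. (fst (c' v), B_of v, snd (c' v), psi_of v))) (at q)"
    unfolding lag_of_def[abs_def]
    by (intro has_derivative_Pair has_derivative_fst[OF dc] has_derivative_snd[OF dc] dlin comp)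
  from diff_chain_at[OF this has_derivative_grad[OF smooth_on_differentiable[OF L UNIV_I]]]
  have dL: "((\<lambda>q. L (lag_of L q)) has_derivative
      (\<lambda>v. g \<bullet> (fst (c' v), B_of v, snd (c' v), psi_of v))) (at q)"
    by (simp add: o_def g_def)
  have "((\<lambda>q. fst (conjugate_vars L q) \<bullet> D_of q + snd (conjugate_vars L q) * phi_of q - L (lag_of L q))
    has_derivative (\<lambda>v. (fst c \<bullet> D_of v + fst (c' v) \<bullet> D_of q)
      + (snd c * phi_of v + snd (c' v) * phi_of q) - g \<bullet> (fst (c' v), B_of v, snd (c' v), psi_of v))) (at q)"
    unfolding c_def
    by (intro has_derivative_diff has_derivative_add has_derivative_inner has_derivative_mult dL
        has_derivative_fst[OF dc] has_derivative_snd[OF dc] dlin comp)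
  moreover have "(\<lambda>v. (fst c \<bullet> D_of v + fst (c' v) \<bullet> D_of q)
      + (snd c * phi_of v + snd (c' v) * phi_of q) - g \<bullet> (fst (c' v), B_of v, snd (c' v), psi_of v))
    = (\<lambda>v. (- fst (snd g), snd c, fst c, - snd (snd (snd g))) \<bullet> v)"
    using Dphi by (simp add: fun_eq_iff inner_prod_def component_defs inner_commute)
  ultimately show "(energy L has_derivative (\<lambda>v. (- fst (snd (grad L (lag_of L q))), snd (conjugate_vars L q),
    fst (conjugate_vars L q), - snd (snd (snd (grad L (lag_of L q))))) \<bullet> v)) (at q)"
    by (simp add: energy_eq[abs_def] c_def g_def)
qed

lemma em_fields_eq:
  "em_fields J = (- fst (fst (snd J)),
     \<chi> k. (\<Sum>i\<in>UNIV. \<Sum>j\<in>UNIV. eps k i j * fst (snd (snd J) $ i) $ j) + snd (snd (snd J) $ k),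
     - snd (fst (snd J)), \<Sum>k\<in>UNIV. fst (snd (snd J) $ k) $ k)"
  by (cases J rule: em_fields.cases) simp

lemma linear_em_fields: "linear em_fields"
  by (rule linearI) (simp_all add: em_fields_eq vec_eq_iff forall_3 sum_3 eps_def distrib_left right_diff_distrib)

lemma bounded_linear_em_fields: "bounded_linear em_fields"
  using linear_em_fields by (simp add: linear_conv_bounded_linear)

lemma frechet_derivative_lagrangian_density:
  assumes "smooth_on UNIV L"
  shows "frechet_derivative (lagrangian_density L) (at J) w = grad L (em_fields J) \<bullet> em_fields w"
proof -
  have "(lagrangian_density L has_derivative (\<lambda>w. grad L (em_fields J) \<bullet> em_fields w)) (at J)"
    using diff_chain_at[OF bounded_linear.has_derivative[OF bounded_linear_em_fields has_derivative_ident]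
      has_derivative_grad[OF smooth_on_differentiable[OF assms UNIV_I]]]
    by (simp add: o_def lagrangian_density_def[abs_def])
  from fun_cong[OF frechet_derivative_at[OF this]] show ?thesis by simp
qed

lemma smooth_on_vec_lambda:
  fixes f :: "'n::finite \<Rightarrow> 'a::euclidean_space \<Rightarrow> 'b::euclidean_space"
  assumes "open S" "\<And>k. smooth_on S (f k)"
  shows "smooth_on S (\<lambda>x. \<chi> k. f k x)"
proof -
  have bl: "bounded_linear (axis k :: 'b \<Rightarrow> 'b^'n)" for k
    unfolding linear_conv_bounded_linear[symmetric]
    by (rule linearI) (auto simp: axis_def vec_eq_iff)
  have "smooth_on S (\<lambda>x. \<Sum>k\<in>UNIV. axis k (f k x))"
    by (intro smooth_on_sum smooth_on_linear[OF bl] assms)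
  moreover have "(\<Sum>k\<in>UNIV. axis k (f k x)) = (\<chi> k. f k x)" for x
    by (simp add: vec_eq_iff axis_def if_distrib[of "\<lambda>v. v $ _"] cong: if_cong)
  ultimately show ?thesis by simp
qed

lemma smooth_on_jet:
  assumes u: "smooth_on \<Omega> u"
  shows "smooth_on \<Omega> (jet u)"
proof -
  have "smooth_on \<Omega> (\<lambda>X. (u X, dt u X, \<chi> k. dx k u X))"
    unfolding dt_def dx_def
    by (intro smooth_on_Pair smooth_on_vec_lambda u smooth_on_deriv[OF u] smooth_onD_open[OF u])
  then show ?thesis by (rule smooth_on_cong) (simp add: jet_def)
qed

lemma dt_dx_commute:
  "smooth_on \<Omega> u \<Longrightarrow> X \<in> \<Omega> \<Longrightarrow> dx k (dt u) X = dt (dx k u) X"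
  unfolding dt_def[abs_def] dx_def[abs_def] by (rule second_derivative_symmetric)

lemma dt_jet:
  assumes u: "smooth_on \<Omega> u" and X: "X \<in> \<Omega>"
  shows "dt (jet u) X = (dt u X, dt (dt u) X, \<chi> i. dt (dx i u) X)"
proof -
  note d = smooth_on_differentiable[OF smooth_on_jet[OF u] X]
  note dl = dt_linear[OF _ d]
  have "bounded_linear (\<lambda>J :: 'a jet. snd (snd J) $ i)" for i
    by (intro bounded_linear_compose[OF bounded_linear_vec_nth] bounded_linear_compose[OF bounded_linear_snd] bounded_linear_snd)
  note dl[OF this] dl[OF bounded_linear_fst] dl[OF bounded_linear_compose[OF bounded_linear_fst bounded_linear_snd]]
  then show ?thesis
    by (simp add: jet_def prod_eq_iff vec_eq_iff)
qed

lemma dx_jet: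
  assumes u: "smooth_on \<Omega> u" and X: "X \<in> \<Omega>"
  shows "dx k (jet u) X = (dx k u X, dx k (dt u) X, \<chi> i. dx k (dx i u) X)"
proof -
  note d = smooth_on_differentiable[OF smooth_on_jet[OF u] X]
  note dl = dx_linear[OF _ d]
  have "bounded_linear (\<lambda>J :: 'a jet. snd (snd J) $ i)" for i
    by (intro bounded_linear_compose[OF bounded_linear_vec_nth] bounded_linear_compose[OF bounded_linear_snd] bounded_linear_snd)
  note dl[OF this] dl[OF bounded_linear_fst] dl[OF bounded_linear_compose[OF bounded_linear_fst bounded_linear_snd]]
  then show ?thesis
    by (simp add: jet_def prod_eq_iff vec_eq_iff)
qed

text \<open>A state and its dual, written in terms of a point \<open>l\<close> of the Lagrangian variables and the
  gradient \<open>g\<close> of the Lagrangian there. In the pair \<open>(l, g)\<close> both are linear, so along a field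
  their derivatives are obtained from those of \<open>l\<close> and \<open>g\<close> by substitution.\<close>

definition primal_state :: "lag_vars \<Rightarrow> lag_vars \<Rightarrow> state" where
  "primal_state l g = (fst (snd l), fst (snd (snd g)), fst g, snd (snd (snd l)))"

definition dual_state :: "lag_vars \<Rightarrow> lag_vars \<Rightarrow> state" where
  "dual_state l g = (- fst (snd g), fst (snd (snd l)), fst l, - snd (snd (snd g)))"

lemma state_of_eq:
  assumes "smooth_on UNIV L"
  shows "state_of L A Z X = primal_state (em_fields (jet (\<lambda>Y. (A Y, Z Y)) X))
    (grad L (em_fields (jet (\<lambda>Y. (A Y, Z Y)) X)))"
  by (simp add: state_of_def Let_def case_prod_unfold legendre_map_eq_grad[OF assms] primal_state_def)

lemma primal_state_in_domain:
  assumes L: "smooth_on UNIV L" and wd: "partial_legendre_well_defined L"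
  shows "primal_state l (grad L l) \<in> legendre_domain L"
    and "grad (energy L) (primal_state l (grad L l)) = dual_state l (grad L l)"
proof -
  obtain E B \<phi> \<psi> where l: "l = (E, B, \<phi>, \<psi>)" by (cases l rule: prod_cases4)
  have m: "legendre_map L B \<psi> (E, \<phi>) = (fst (grad L l), fst (snd (snd (grad L l))))"
    by (simp add: legendre_map_eq_grad[OF L] l)
  then show dom: "primal_state l (grad L l) \<in> legendre_domain L"
    unfolding legendre_domain_def primal_state_def by (simp add: l) (metis rangeI)
  have "inj (legendre_map L B \<psi>)"
    using wd by (simp add: partial_legendre_well_defined_def diffeo_onto_image_def)
  then have c: "conjugate_vars L (primal_state l (grad L l)) = (E, \<phi>)"
    unfolding conjugate_vars_def component_defs primal_state_def using m
    by (simp add: l) (metis inv_f_f)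
  then have "lag_of L (primal_state l (grad L l)) = l"
    by (simp add: lag_of_def primal_state_def component_defs l)
  with c show "grad (energy L) (primal_state l (grad L l)) = dual_state l (grad L l)"
    using grad_energy[OF L wd dom] by (simp add: dual_state_def l)
qed

text \<open>The equations for \<open>B\<close> and \<open>\<psi>\<close> only express that \<open>\<partial>\<^sub>t\<close> and \<open>\<partial>\<^sub>k\<close> commute on the potentials;
  those for \<open>D\<close> and \<open>\<phi>\<close> are the Euler--Lagrange equations for \<open>A\<close> and \<open>Z\<close>.\<close>

lemma euler_lagrange_imp_solution:
  assumes L: "smooth_on UNIV L" and wd: "partial_legendre_well_defined L"
    and A: "smooth_on \<Omega> A" and Z: "smooth_on \<Omega> Z"
    and EL: "euler_lagrange (lagrangian_density L) \<Omega> (\<lambda>X. (A X, Z X))"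
  shows "smooth_solution (legendre_domain L) (energy L) \<Omega> (state_of L A Z)"
proof -
  define u where "u = (\<lambda>X. (A X, Z X))"
  define l where "l X = em_fields (jet u X)" for X
  define g where "g X = grad L (l X)" for X
  have u: "smooth_on \<Omega> u" unfolding u_def by (rule smooth_on_Pair[OF A Z])
  have l: "smooth_on \<Omega> l"
    unfolding l_def by (rule smooth_on_linear[OF bounded_linear_em_fields smooth_on_jet[OF u]])
  have g: "smooth_on \<Omega> g"
    unfolding g_def by (rule smooth_on_compose[OF l smooth_on_grad[OF L]]) simp
  have lg: "smooth_on \<Omega> (\<lambda>X. (l X, g X))" by (rule smooth_on_Pair[OF l g])
  have lin: "bounded_linear (\<lambda>z. primal_state (fst z) (snd z))" "bounded_linear (\<lambda>z. dual_state (fst z) (snd z))"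
    unfolding linear_conv_bounded_linear[symmetric]
    by (rule linearI; simp add: primal_state_def dual_state_def)+
  have q_eq: "state_of L A Z = (\<lambda>X. primal_state (l X) (g X))"
    by (simp add: fun_eq_iff state_of_eq[OF L] l_def g_def u_def)
  have p_eq: "grad (energy L) (state_of L A Z X) = dual_state (l X) (g X)" for X
    by (simp add: q_eq g_def primal_state_in_domain[OF L wd])
  have q: "smooth_on \<Omega> (state_of L A Z)" "state_of L A Z ` \<Omega> \<subseteq> legendre_domain L"
    using smooth_on_linear[OF lin(1) lg] primal_state_in_domain(1)[OF L wd]
    unfolding q_eq g_def by (simp, blast)
  show ?thesis
    unfolding smooth_solution_iff[OF smooth_on_energy[OF L wd] q]
  proof
    fix X assume X: "X \<in> \<Omega>"
    define U where "U = dt (dt u) X"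
    define M where "M i = dt (dx i u) X" for i
    note dg = smooth_on_differentiable[OF g X] and dl = smooth_on_differentiable[OF l X]
    note dlg = smooth_on_differentiable[OF lg X]
    have dt_pair: "dt (\<lambda>X. (l X, g X)) X = (dt l X, dt g X)"
      using dt_linear[OF bounded_linear_fst dlg] dt_linear[OF bounded_linear_snd dlg] by (simp add: prod_eq_iff)
    have dx_pair: "dx k (\<lambda>X. (l X, g X)) X = (dx k l X, dx k g X)" for k
      using dx_linear[OF bounded_linear_fst dlg] dx_linear[OF bounded_linear_snd dlg] by (simp add: prod_eq_iff)
    have dtq: "dt (state_of L A Z) X = primal_state (dt l X) (dt g X)"
      using dt_linear[OF lin(1) dlg] by (simp add: q_eq dt_pair)
    have dxp: "dx k (\<lambda>Y. grad (energy L) (state_of L A Z Y)) X = dual_state (dx k l X) (dx k g X)" for k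
      using dx_linear[OF lin(2) dlg] by (simp add: p_eq dx_pair)
    have dtl: "dt l X = em_fields (dt u X, U, \<chi> i. M i)"
      unfolding l_def U_def M_def using smooth_on_differentiable[OF smooth_on_jet[OF u] X]
      by (simp add: dt_linear[OF bounded_linear_em_fields] dt_jet[OF u X])
    have dxl: "dx k l X = em_fields (dx k u X, M k, \<chi> i. dx k (dx i u) X)" for k
      unfolding l_def M_def using smooth_on_differentiable[OF smooth_on_jet[OF u] X]
      by (simp add: dx_linear[OF bounded_linear_em_fields] dx_jet[OF u X] dt_dx_commute[OF u X])
    have EL': "- (dt g X \<bullet> em_fields (0, i, 0)) - (\<Sum>k\<in>UNIV. dx k g X \<bullet> em_fields (0, 0, axis k i)) = 0"
      if i: "i \<in> Basis" for i
    proof -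
      have "dt (\<lambda>Y. g Y \<bullet> w) X = dt g X \<bullet> w" "dx k (\<lambda>Y. g Y \<bullet> w) X = dx k g X \<bullet> w" for k w
        by (rule dt_linear[OF bounded_linear_inner_left dg] dx_linear[OF bounded_linear_inner_left dg])+
      moreover have "em_fields (i, 0, 0) = 0"
        by (simp add: em_fields_eq zero_prod_def vec_eq_iff)
      moreover have "- dt (\<lambda>Y. g Y \<bullet> em_fields (0, i, 0)) X
          - (\<Sum>k\<in>UNIV. dx k (\<lambda>Y. g Y \<bullet> em_fields (0, 0, axis k i)) X) + g X \<bullet> em_fields (i, 0, 0) = 0"
        using EL X i unfolding euler_lagrange_def frechet_derivative_lagrangian_density[OF L]
        unfolding u_def[symmetric] l_def[symmetric] g_def[symmetric] by blast
      ultimately show ?thesis by simp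
    qed
    have EL_A: "- (dt g X \<bullet> em_fields (0, (axis j 1, 0), 0))
        - (\<Sum>k\<in>UNIV. dx k g X \<bullet> em_fields (0, 0, axis k (axis j 1, 0))) = 0" for j
      by (rule EL') (auto simp: Basis_prod_def Basis_vec_def)
    have EL_Z: "- (dt g X \<bullet> em_fields (0, (0, 1), 0))
        - (\<Sum>k\<in>UNIV. dx k g X \<bullet> em_fields (0, 0, axis k (0, 1))) = 0"
      by (rule EL') (auto simp: Basis_prod_def)
    show "dt (state_of L A Z) X + (\<Sum>k\<in>UNIV. H_op k (dx k (\<lambda>Y. grad (energy L) (state_of L A Z Y)) X)) = 0"
    proof -
      define G0 where "G0 = dt g X"
      define G where "G k = dx k g X" for k
      have A: "fst G0 $ j = (\<Sum>k\<in>UNIV. \<Sum>m\<in>UNIV. eps m k j * fst (snd (G k)) $ m) + snd (snd (snd (G j)))" for j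
        using EL_A[of j] exhaust_3[of j] unfolding G0_def[symmetric] G_def[symmetric]
        by (elim disjE) (simp_all add: em_fields_eq inner_prod_def inner_vec_def sum_3 axis_def eps_def algebra_simps)
      have Z: "fst (snd (snd G0)) = (\<Sum>k\<in>UNIV. fst (snd (G k)) $ k)"
        using EL_Z unfolding G0_def[symmetric] G_def[symmetric]
        by (simp add: em_fields_eq inner_prod_def inner_vec_def sum_3 axis_def eps_def algebra_simps)
      show ?thesis
        unfolding dtq dxp dtl dxl system_eq_H_op_form[symmetric] G0_def[symmetric] G_def[symmetric]
        by (simp add: primal_state_def dual_state_def component_defs em_fields_eq A Z forall_3 sum_3 eps_def algebra_simps)
    qed
  qed
qed

section \<open>The evolution system of the Lagrangian\<close>

theorem mainTheorem3:
  fixes L :: "lag_vars \<Rightarrow> real"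
  assumes "smooth_on UNIV L"
    and "partial_legendre_well_defined L"
  shows "smooth_on (legendre_domain L) (energy L) \<and>
    (\<forall>\<Omega> A Z. smooth_on \<Omega> A \<and> smooth_on \<Omega> Z \<and>
        euler_lagrange (lagrangian_density L) \<Omega> (\<lambda>X. (A X, Z X)) \<longrightarrow>
        smooth_solution (legendre_domain L) (energy L) \<Omega> (state_of L A Z)) \<and>
    (\<forall>\<Omega> q. smooth_solution (legendre_domain L) (energy L) \<Omega> q \<longrightarrow>
        energy_conservation (energy L) \<Omega> q) \<and>
    (\<forall>V. open V \<and> V \<subseteq> legendre_domain L \<and> (\<forall>q\<in>V. pos_def_op (hess (energy L) q)) \<longrightarrow>
        (convex_on V (energy L) \<longrightarrow> inj_on (grad (energy L)) V) \<and>
        (\<forall>q\<in>V. \<exists>V'. open V' \<and> q \<in> V' \<and> V' \<subseteq> V \<and> inj_on (grad (energy L)) V') \<and>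
        (inj_on (grad (energy L)) V \<longrightarrow>
           diffeo_onto_image V (grad (energy L)) \<and>
           smooth_on (grad (energy L) ` V) (legendre_potential V (energy L)) \<and>
           symmetric_hyperbolic (grad (energy L) ` V)
             (hess (legendre_potential V (energy L))) H_op \<and>
           (\<forall>\<Omega> q. smooth_on \<Omega> q \<and> q ` \<Omega> \<subseteq> V \<longrightarrow>
              (smooth_solution (legendre_domain L) (energy L) \<Omega> q \<longleftrightarrow>
               satisfies_quasilinear (hess (legendre_potential V (energy L))) H_op \<Omega>
                 (\<lambda>X. grad (energy L) (q X))))))"
proof -
  let ?E = "energy L" and ?W = "legendre_domain L"
  have E: "smooth_on ?W ?E" by (rule smooth_on_energy[OF assms])
  have conv: "inj_on (grad ?E) C"
    if "V \<subseteq> ?W" "\<forall>q\<in>V. pos_def_op (hess ?E q)" "convex C" "C \<subseteq> V" for V C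
    using that by (intro grad_inj_on_convex[OF E]) auto
  have loc: "\<exists>V'. open V' \<and> q \<in> V' \<and> V' \<subseteq> V \<and> inj_on (grad ?E) V'"
    if V: "open V" "V \<subseteq> ?W" "\<forall>q\<in>V. pos_def_op (hess ?E q)" and q: "q \<in> V" for V q
  proof -
    obtain e where "e > 0" "ball q e \<subseteq> V"
      using V(1) q openE by blast
    then show ?thesis
      using conv[OF V(2,3) convex_ball[of q e]] by (intro exI[of _ "ball q e"]) auto
  qed
  have main: "diffeo_onto_image V (grad ?E) \<and> smooth_on (grad ?E ` V) (legendre_potential V ?E) \<and>
      symmetric_hyperbolic (grad ?E ` V) (hess (legendre_potential V ?E)) H_op \<and>
      (\<forall>\<Omega> q. smooth_on \<Omega> q \<and> q ` \<Omega> \<subseteq> V \<longrightarrow>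
        (smooth_solution ?W ?E \<Omega> q \<longleftrightarrow>
          satisfies_quasilinear (hess (legendre_potential V ?E)) H_op \<Omega> (\<lambda>X. grad ?E (q X))))"
    if V: "open V" "V \<subseteq> ?W" and pos: "\<forall>q\<in>V. pos_def_op (hess ?E q)" and inj: "inj_on (grad ?E) V" for V
  proof -
    have EV: "smooth_on V ?E" by (rule smooth_on_subset[OF E V(2,1)])
    have pos': "\<And>q. q \<in> V \<Longrightarrow> pos_def_op (hess ?E q)" using pos by blast
    have "symmetric_hyperbolic (grad ?E ` V) (hess (legendre_potential V ?E)) H_op"
      unfolding symmetric_hyperbolic_def
      using hess_legendre_potential_pos_def[OF EV pos' inj] symmetric_H_op by blast
    then show ?thesis
      using grad_diffeo(1)[OF EV pos' inj] smooth_on_legendre_potential[OF EV pos' inj]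
        smooth_solution_iff_quasilinear[OF E V pos' inj] by blast
  qed
  show ?thesis
  proof (intro conjI allI impI ballI; (elim conjE)?)
    show "smooth_on ?W ?E" by (rule E)
  next
    fix \<Omega> A Z
    assume "smooth_on \<Omega> A" "smooth_on \<Omega> Z" "euler_lagrange (lagrangian_density L) \<Omega> (\<lambda>X. (A X, Z X))"
    then show "smooth_solution ?W ?E \<Omega> (state_of L A Z)"
      by (rule euler_lagrange_imp_solution[OF assms])
  next
    fix \<Omega> q assume "smooth_solution ?W ?E \<Omega> q"
    then show "energy_conservation ?E \<Omega> q" by (rule energy_conservation_of_solution[OF E])
  next
    fix V assume "open V" "V \<subseteq> ?W" "\<forall>q\<in>V. pos_def_op (hess ?E q)" "convex_on V ?E"
    then show "inj_on (grad ?E) V"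
      using conv[of V V] by (simp add: convex_on_def)
  next
    fix V q assume "open V" "V \<subseteq> ?W" "\<forall>q\<in>V. pos_def_op (hess ?E q)" "q \<in> V"
    then show "\<exists>V'. open V' \<and> q \<in> V' \<and> V' \<subseteq> V \<and> inj_on (grad ?E) V'" by (rule loc)
  qed (use main in blast)+
qed

end
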